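(* Let $A$ be a $C^*$-algebra, let $\mathcal K$ be the algebra of compact operators on an infinite-dimensional separable Hilbert space, and let $P\in\mathcal K\otimes A$ be a projection. Then the space $S_P(\mathcal K\otimes A)=\{V\in\mathcal K\otimes A: V^*V=P\}$ of partial isometries in $\mathcal K\otimes A$ with initial space $P$, with the norm topology, is contractible.
   Context: Projection means self-adjoint idempotent. *)

theory Defs
  imports "HOL-Analysis.Analysis"
begin

section \<open>Complex vector spaces and Hilbert spaces\<close>

class complex_vector = real_vector +
  fixes scaleC :: "complex \<Rightarrow> 'a \<Rightarrow> 'a" (infixr "*\<^sub>C" 75)
  assumes scaleC_add_right: "c *\<^sub>C (x + y) = c *\<^sub>C x + c *\<^sub>C y"
    and scaleC_add_left: "(c + d) *\<^sub>C x = c *\<^sub>C x + d *\<^sub>C x"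
    and scaleC_scaleC: "c *\<^sub>C (d *\<^sub>C x) = (c * d) *\<^sub>C x"
    and scaleC_one: "1 *\<^sub>C x = x"
    and scaleR_scaleC: "r *\<^sub>R x = complex_of_real r *\<^sub>C x"

global_interpretation complex_vector: vector_space "scaleC :: complex \<Rightarrow> 'a \<Rightarrow> 'a::complex_vector"
  by unfold_locales (rule scaleC_add_right scaleC_add_left scaleC_scaleC scaleC_one)+

class complex_normed_vector = complex_vector + real_normed_vector +
  assumes norm_scaleC: "norm (c *\<^sub>C x) = cmod c * norm x"

text \<open>The inner product is linear in the second argument.\<close>

class complex_inner = complex_normed_vector +
  fixes cinner :: "'a \<Rightarrow> 'a \<Rightarrow> complex"
  assumes cinner_commute: "cinner x y = cnj (cinner y x)"
    and cinner_add_right: "cinner x (y + z) = cinner x y + cinner x z"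
    and cinner_scaleC_right: "cinner x (c *\<^sub>C y) = c * cinner x y"
    and cinner_self: "cinner x x = complex_of_real ((norm x)\<^sup>2)"

class complex_hilbert = complex_inner + banach


section \<open>C*-algebras\<close>

text \<open>No unit is required, and the zero algebra is allowed.\<close>

class cstar_algebra = complex_normed_vector + real_normed_algebra + banach +
  fixes adj :: "'a \<Rightarrow> 'a"
  assumes mult_scaleC_left: "(c *\<^sub>C x) * y = c *\<^sub>C (x * y)"
    and mult_scaleC_right: "x * (c *\<^sub>C y) = c *\<^sub>C (x * y)"
    and adj_adj: "adj (adj x) = x"
    and adj_add: "adj (x + y) = adj x + adj y"
    and adj_scaleC: "adj (c *\<^sub>C x) = cnj c *\<^sub>C adj x"
    and adj_mult: "adj (x * y) = adj y * adj x"
    and cstar_identity: "norm (adj x * x) = (norm x)\<^sup>2"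

definition is_projection :: "'a::cstar_algebra \<Rightarrow> bool"
  where "is_projection p \<longleftrightarrow> adj p = p \<and> p * p = p"

text \<open>For a projection \<open>p\<close> these are the partial isometries with initial projection \<open>p\<close>.\<close>

definition partial_isometries_from :: "'a::cstar_algebra \<Rightarrow> 'a set"
  where "partial_isometries_from p = {v. adj v * v = p}"

text \<open>
  \<open>is_cstar_tensor_product \<tau>\<close> says that the C*-algebra \<open>'c\<close>, with \<open>\<tau> a b\<close> in the role of
  \<open>a \<otimes> b\<close>, is the completion of the algebraic tensor product of the C*-algebras \<open>'a\<close> and \<open>'b\<close>
  in some C*-norm: \<open>\<tau>\<close> is bilinear and compatible with product and involution, the linear map it
  induces on the algebraic tensor product is injective (every element of the latter can be written
  as \<open>\<Sum>x\<in>S. x \<otimes> f x\<close> with \<open>S\<close> finite and independent, and vanishes only if \<open>f = 0\<close> on \<open>S\<close>),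
  and its range is dense. If \<open>'a\<close> is nuclear, as the compact operators are, there is only one C*-norm
  on the algebraic tensor product, so this determines \<open>'c\<close> up to isomorphism.
\<close>

definition is_cstar_tensor_product ::
    "('a::cstar_algebra \<Rightarrow> 'b::cstar_algebra \<Rightarrow> 'c::cstar_algebra) \<Rightarrow> bool"
  where "is_cstar_tensor_product \<tau> \<longleftrightarrow>
    (\<forall>x y b. \<tau> (x + y) b = \<tau> x b + \<tau> y b) \<and>
    (\<forall>x a b. \<tau> x (a + b) = \<tau> x a + \<tau> x b) \<and>
    (\<forall>c x b. \<tau> (c *\<^sub>C x) b = c *\<^sub>C \<tau> x b) \<and>
    (\<forall>c x b. \<tau> x (c *\<^sub>C b) = c *\<^sub>C \<tau> x b) \<and>
    (\<forall>x y a b. \<tau> x a * \<tau> y b = \<tau> (x * y) (a * b)) \<and>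
    (\<forall>x b. adj (\<tau> x b) = \<tau> (adj x) (adj b)) \<and>
    (\<forall>S f. finite S \<longrightarrow> \<not> complex_vector.dependent S \<longrightarrow> (\<Sum>x\<in>S. \<tau> x (f x)) = 0
        \<longrightarrow> (\<forall>x\<in>S. f x = 0)) \<and>
    closure (complex_vector.span {\<tau> x b |x b. True}) = UNIV"


section \<open>Adjoints of bounded operators on a Hilbert space\<close>

lemma cinner_add_left: "cinner (x + y) z = cinner x z + cinner y z"
  by (metis cinner_add_right cinner_commute complex_cnj_add)

lemma cinner_scaleC_left: "cinner (c *\<^sub>C x) y = cnj c * cinner x y"
  by (metis cinner_commute cinner_scaleC_right complex_cnj_mult)

lemma cinner_minus_right: "cinner x (- y) = - cinner x y"
  using cinner_scaleC_right[of x "-1" y] by simp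

lemma cinner_diff_right: "cinner x (y - z) = cinner x y - cinner x z"
  using cinner_add_right[of x y "- z"] by (simp add: cinner_minus_right)

lemma cinner_diff_left: "cinner (x - y) z = cinner x z - cinner y z"
  by (metis cinner_diff_right cinner_commute complex_cnj_diff)

lemma cinner_zero_left [simp]: "cinner 0 x = 0"
  using cinner_diff_left[of x x x] by simp

lemma cinner_zero_right [simp]: "cinner x 0 = 0"
  using cinner_diff_right[of x x x] by simp

lemma cinner_scaleR_right: "cinner x (r *\<^sub>R y) = of_real r * cinner x y"
  by (simp add: scaleR_scaleC cinner_scaleC_right)

lemma cinner_scaleR_left: "cinner (r *\<^sub>R x) y = of_real r * cinner x y"
  by (simp add: scaleR_scaleC cinner_scaleC_left)

lemma norm_add_square_cinner:
  "(norm (x + y))\<^sup>2 = (norm x)\<^sup>2 + 2 * Re (cinner x y) + (norm y)\<^sup>2"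
proof -
  have "cinner (x + y) (x + y) = cinner x x + cinner x y + cnj (cinner x y) + cinner y y"
    by (simp add: cinner_add_left cinner_add_right flip: cinner_commute[of y x])
  then show ?thesis
    unfolding cinner_self by (simp add: complex_eq_iff)
qed

lemma Re_cinner_le: "Re (cinner x y) \<le> norm x * norm y"
proof -
  have "(norm (x + y))\<^sup>2 \<le> (norm x + norm y)\<^sup>2"
    by (intro power_mono norm_triangle_ineq) simp
  then show ?thesis
    by (simp add: norm_add_square_cinner power2_sum)
qed

lemma cmod_cinner_le: "cmod (cinner x y) \<le> norm x * norm y"
proof -
  obtain u where u: "cmod u = 1" "of_real (cmod (cinner x y)) = u * cinner x y"
  proof (cases "cinner x y = 0")
    case True
    then show ?thesis using that[of 1] by simp
  next
    case False
    then show ?thesis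
      using that[of "cmod (cinner x y) / cinner x y"] by (simp add: norm_divide)
  qed
  have "cmod (cinner x y) = Re (cinner x (u *\<^sub>C y))"
    by (metis Re_complex_of_real cinner_scaleC_right u(2))
  also have "\<dots> \<le> norm x * norm y"
    using Re_cinner_le[of x "u *\<^sub>C y"] by (simp add: norm_scaleC u)
  finally show ?thesis .
qed

lemma cinner_extensionality: "(\<And>x. cinner x y = cinner x z) \<Longrightarrow> y = z"
  using cinner_self[of "y - z"] by (simp add: cinner_diff_right)

lemma parallelogram: "(norm (x - y))\<^sup>2 = 2 * (norm x)\<^sup>2 + 2 * (norm y)\<^sup>2 - (norm (x + y))\<^sup>2"
  for x y :: "'a::complex_inner"
  using norm_add_square_cinner[of x y] norm_add_square_cinner[of x "- y"]
  by (simp add: cinner_minus_right)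

lemma riesz_real:
  fixes f :: "'a::complex_hilbert \<Rightarrow> real"
  assumes "bounded_linear f"
  shows "\<exists>z. \<forall>x. f x = Re (cinner z x)"
proof -
  interpret f: bounded_linear f by fact
  define J where "J x = (norm x)\<^sup>2 / 2 - f x" for x
  obtain M where M: "\<And>x. norm (f x) \<le> norm x * M"
    using f.bounded by blast
  have lower: "- (M\<^sup>2 / 2) \<le> J x" for x
    using M[of x] sum_squares_bound[of "norm x" M]
    by (simp add: J_def abs_le_iff)
  define m where "m = Inf (range J)"
  have bdd: "bdd_below (range J)"
    by (rule bdd_belowI[of _ "- (M\<^sup>2 / 2)"]) (use lower in auto)
  have m_le: "m \<le> J x" for x
    unfolding m_def by (rule cInf_lower) (use bdd in auto)
  have "\<exists>x. J x < m + inverse (Suc n)" for n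
    using cInf_lessD[of "range J" "m + inverse (Suc n)"] by (auto simp: m_def)
  then obtain X where X: "\<And>n. J (X n) < m + inverse (real (Suc n))"
    by metis
  have mid: "(norm (x - y))\<^sup>2 \<le> 4 * (J x - m) + 4 * (J y - m)" for x y
  proof -
    have "(norm (x - y))\<^sup>2 = 4 * J x + 4 * J y - 8 * J ((1/2) *\<^sub>R (x + y))"
      by (simp add: J_def f.add f.scaleR parallelogram power_mult_distrib power_divide
          add_divide_distrib)
    then show ?thesis using m_le[of "(1/2) *\<^sub>R (x + y)"] by simp
  qed
  have "Cauchy X"
  proof (rule metric_CauchyI)
    fix e :: real assume "e > 0"
    then obtain N where N: "inverse (real (Suc N)) < e\<^sup>2 / 8"
      using reals_Archimedean[of "e\<^sup>2 / 8"] by auto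
    have small: "J (X n) - m < e\<^sup>2 / 8" if "n \<ge> N" for n
    proof -
      have "inverse (real (Suc n)) \<le> inverse (real (Suc N))"
        using that by (simp add: field_simps)
      then show ?thesis using X[of n] N by linarith
    qed
    have "dist (X i) (X j) < e" if "i \<ge> N" "j \<ge> N" for i j
    proof -
      have "(norm (X i - X j))\<^sup>2 < e\<^sup>2"
        using mid[of "X i" "X j"] small[OF that(1)] small[OF that(2)] by (simp add: field_simps)
      then show ?thesis
        using \<open>e > 0\<close> by (simp add: dist_norm power_less_imp_less_base)
    qed
    then show "\<exists>N. \<forall>i\<ge>N. \<forall>j\<ge>N. dist (X i) (X j) < e" by blast
  qed
  then obtain z where z: "X \<longlonglongrightarrow> z"
    using Cauchy_convergent_iff convergent_def by blast
  have "(\<lambda>n. J (X n)) \<longlonglongrightarrow> J z"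
    unfolding J_def by (intro tendsto_intros z f.tendsto) simp
  moreover have "(\<lambda>n. m + inverse (real (Suc n))) \<longlonglongrightarrow> m + 0"
    by (intro tendsto_intros LIMSEQ_inverse_real_of_nat)
  ultimately have "J z \<le> m + 0"
    by (rule LIMSEQ_le) (use X in \<open>auto intro: less_imp_le\<close>)
  then have min: "J z \<le> J x" for x
    using m_le[of x] by linarith
  have "f h = Re (cinner z h)" for h
  proof -
    define d where "d = f h - Re (cinner z h)"
    have *: "0 \<le> t\<^sup>2 * (norm h)\<^sup>2 / 2 - t * d" for t
    proof -
      have "J (z + t *\<^sub>R h) = J z + t\<^sup>2 * (norm h)\<^sup>2 / 2 - t * d"
        by (simp add: J_def d_def norm_add_square_cinner f.add f.scaleR cinner_scaleR_right
            power_mult_distrib algebra_simps add_divide_distrib)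
      then show ?thesis using min[of "z + t *\<^sub>R h"] by linarith
    qed
    have "d = 0"
    proof (cases "h = 0")
      case True
      then show ?thesis by (simp add: d_def f.zero)
    next
      case False
      then show ?thesis
        using *[of "d / (norm h)\<^sup>2"] by (auto simp: field_simps power2_eq_square mult_le_0_iff)
    qed
    then show ?thesis by (simp add: d_def)
  qed
  then show ?thesis by blast
qed

definition complex_linear :: "('a::complex_vector \<Rightarrow> 'b::complex_vector) \<Rightarrow> bool"
  where "complex_linear f \<longleftrightarrow> (\<forall>x y. f (x + y) = f x + f y) \<and> (\<forall>c x. f (c *\<^sub>C x) = c *\<^sub>C f x)"

lemma bounded_linear_if_complex_linear:
  fixes f :: "'a::complex_normed_vector \<Rightarrow> 'b::complex_normed_vector"
  assumes "complex_linear f" "\<And>x. norm (f x) \<le> norm x * K"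
  shows "bounded_linear f"
  by (rule bounded_linear_intro[of _ K])
    (use assms in \<open>auto simp: complex_linear_def scaleR_scaleC\<close>)

lemma ex_adjoint:
  fixes T :: "'a::complex_hilbert \<Rightarrow>\<^sub>L 'a"
  assumes T: "complex_linear (blinfun_apply T)"
  shows "\<exists>S :: 'a \<Rightarrow>\<^sub>L 'a. complex_linear (blinfun_apply S) \<and> (\<forall>x y. cinner (S x) y = cinner x (T y))"
proof -
  have "\<exists>z. \<forall>y. cinner z y = cinner x (T y)" for x
  proof -
    have "bounded_linear (\<lambda>y. Re (cinner x (T y)))"
    proof (rule bounded_linear_intro[of _ "norm x * norm T"])
      fix y
      have "norm x * norm (T y) \<le> norm x * (norm T * norm y)"
        by (intro mult_left_mono norm_blinfun) simp
      then show "norm (Re (cinner x (T y))) \<le> norm y * (norm x * norm T)"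
        using cmod_cinner_le[of x "T y"] abs_Re_le_cmod[of "cinner x (T y)"]
        by (simp add: mult.commute mult.left_commute)
    qed (auto simp: blinfun.add_right blinfun.scaleR_right cinner_add_right cinner_scaleR_right)
    then obtain z where z: "\<And>y. Re (cinner x (T y)) = Re (cinner z y)"
      using riesz_real by blast
    have "Im (cinner x (T y)) = Im (cinner z y)" for y
      using z[of "\<i> *\<^sub>C y"] T by (simp add: complex_linear_def cinner_scaleC_right)
    then show ?thesis using z by (metis complex_eqI)
  qed
  then obtain S where S: "\<And>x y. cinner (S x) y = cinner x (T y)"
    by metis
  have S': "cinner y (S x) = cinner (T y) x" for x y
    by (metis S cinner_commute)
  have lin: "complex_linear S"
    unfolding complex_linear_def
  proof (intro conjI allI)
    show "S (x + y) = S x + S y" for x y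
      by (rule cinner_extensionality) (simp add: S' cinner_add_right)
    show "S (c *\<^sub>C x) = c *\<^sub>C S x" for c x
      by (rule cinner_extensionality) (simp add: S' cinner_scaleC_right)
  qed
  have "norm (S x) \<le> norm x * norm T" for x
  proof (cases "S x = 0")
    case False
    have "complex_of_real ((norm (S x))\<^sup>2) = cinner x (T (S x))"
      using S[of x "S x"] by (simp only: cinner_self)
    then have "(norm (S x))\<^sup>2 = cmod (cinner x (T (S x)))"
      by (metis abs_of_nonneg norm_of_real zero_le_power2)
    also have "\<dots> \<le> norm x * (norm T * norm (S x))"
      by (intro order_trans[OF cmod_cinner_le] mult_left_mono norm_blinfun) simp
    finally show ?thesis using False by (simp add: power2_eq_square)
  qed simp
  then have "bounded_linear S" using lin by (rule bounded_linear_if_complex_linear[rotated])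
  then show ?thesis
    using lin S by (intro exI[of _ "Blinfun S"]) (simp add: bounded_linear_Blinfun_apply)
qed


section \<open>The C*-algebra of compact operators\<close>

definition compact_operator :: "('a::complex_normed_vector \<Rightarrow> 'b::complex_normed_vector) \<Rightarrow> bool"
  where "compact_operator f \<longleftrightarrow> complex_linear f \<and> compact (closure (f ` cball 0 1))"

lemma compact_closure_iff_nets:
  fixes S :: "'a::complete_space set"
  shows "compact (closure S) \<longleftrightarrow> (\<forall>e>0. \<exists>k. finite k \<and> k \<subseteq> S \<and> S \<subseteq> (\<Union>x\<in>k. ball x e))"
proof (intro iffI allI impI)
  fix e :: real assume "compact (closure S)" "e > 0"
  then obtain k where k: "finite k" "closure S \<subseteq> (\<Union>x\<in>k. ball x (e/2))"
    unfolding compact_eq_totally_bounded by (meson half_gt_zero)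
  define g where "g x = (SOME y. y \<in> S \<and> dist x y < e/2)" for x
  define k' where "k' = {x\<in>k. \<exists>y. y \<in> S \<and> dist x y < e/2}"
  have g: "g x \<in> S \<and> dist x (g x) < e/2" if "x \<in> k'" for x
    unfolding g_def by (rule someI_ex) (use that in \<open>auto simp: k'_def\<close>)
  have "S \<subseteq> (\<Union>x\<in>g ` k'. ball x e)"
  proof
    fix y assume y: "y \<in> S"
    then obtain x where x: "x \<in> k" "dist x y < e/2"
      using k(2) closure_subset[THEN subsetD, OF y] by auto
    then have "x \<in> k'" using y by (auto simp: k'_def)
    moreover have "dist (g x) y < e"
      using g[OF \<open>x \<in> k'\<close>] x dist_triangle_half_r by blast
    ultimately show "y \<in> (\<Union>x\<in>g ` k'. ball x e)" by auto
  qed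
  moreover have "finite (g ` k')" "g ` k' \<subseteq> S"
    using k g by (auto simp: k'_def)
  ultimately show "\<exists>k. finite k \<and> k \<subseteq> S \<and> S \<subseteq> (\<Union>x\<in>k. ball x e)" by blast
next
  assume nets: "\<forall>e>0. \<exists>k. finite k \<and> k \<subseteq> S \<and> S \<subseteq> (\<Union>x\<in>k. ball x e)"
  have "\<exists>k. finite k \<and> closure S \<subseteq> (\<Union>x\<in>k. ball x e)" if e: "e > 0" for e
  proof -
    obtain k where k: "finite k" "S \<subseteq> (\<Union>x\<in>k. ball x (e/2))"
      using nets e by (meson half_gt_zero)
    have "S \<subseteq> (\<Union>x\<in>k. cball x (e/2))"
      by (rule order_trans[OF k(2)]) (intro UN_mono ball_subset_cball order_refl)
    then have "closure S \<subseteq> (\<Union>x\<in>k. cball x (e/2))"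
      using k(1) by (intro closure_minimal closed_UN) auto
    also have "\<dots> \<subseteq> (\<Union>x\<in>k. ball x e)"
      using e by (intro UN_mono order_refl) auto
    finally show ?thesis using k(1) by blast
  qed
  then show "compact (closure S)"
    unfolding compact_eq_totally_bounded by (simp add: complete_eq_closed)
qed

lemma compact_closure_if_subset:
  fixes K :: "'a::t2_space set"
  assumes "compact K" "S \<subseteq> K"
  shows "compact (closure S)"
proof -
  have "closure S \<subseteq> K"
    using assms by (intro closure_minimal compact_imp_closed)
  then have "closure S = K \<inter> closure S" by blast
  then show ?thesis
    using compact_Int_closed[OF assms(1) closed_closure, of S] by simp
qed

lemma compact_operator_add:
  assumes "compact_operator f" "compact_operator g"
  shows "compact_operator (\<lambda>x. f x + g x)"
proof -
  let ?K = "{x + y |x y. x \<in> closure (f ` cball 0 1) \<and> y \<in> closure (g ` cball 0 1)}"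
  have "compact ?K"
    using assms by (intro compact_sums) (auto simp: compact_operator_def)
  moreover have "(\<lambda>x. f x + g x) ` cball 0 1 \<subseteq> ?K"
  proof clarify
    fix x :: 'a assume "x \<in> cball 0 1"
    then have "f x \<in> closure (f ` cball 0 1)" "g x \<in> closure (g ` cball 0 1)"
      by (auto intro: closure_subset[THEN subsetD])
    then show "\<exists>y z. f x + g x = y + z \<and> y \<in> closure (f ` cball 0 1) \<and> z \<in> closure (g ` cball 0 1)"
      by (intro exI conjI) (rule refl)
  qed
  ultimately have "compact (closure ((\<lambda>x. f x + g x) ` cball 0 1))"
    by (rule compact_closure_if_subset)
  then show ?thesis
    using assms
    by (auto simp: compact_operator_def complex_linear_def scaleC_add_right)
qed

lemma compact_operator_compose_left:
  assumes "compact_operator f" "bounded_linear g" "complex_linear g"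
  shows "compact_operator (\<lambda>x. g (f x))"
proof -
  let ?K = "g ` closure (f ` cball 0 1)"
  have "compact ?K"
    using assms
    by (intro compact_continuous_image linear_continuous_on) (auto simp: compact_operator_def)
  moreover have "(\<lambda>x. g (f x)) ` cball 0 1 \<subseteq> ?K"
    by (auto intro!: closure_subset[THEN subsetD])
  ultimately have "compact (closure ((\<lambda>x. g (f x)) ` cball 0 1))"
    by (rule compact_closure_if_subset)
  then show ?thesis
    using assms by (auto simp: compact_operator_def complex_linear_def)
qed

lemma bounded_linear_scaleC: "bounded_linear (\<lambda>x::'a::complex_normed_vector. c *\<^sub>C x)"
  by (rule bounded_linear_if_complex_linear[of _ "cmod c"])
    (auto simp: complex_linear_def scaleC_add_right scaleC_scaleC norm_scaleC mult.commute)

lemma compact_operator_scaleC: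
  assumes "compact_operator f"
  shows "compact_operator (\<lambda>x. c *\<^sub>C f x)"
  by (rule compact_operator_compose_left[OF assms bounded_linear_scaleC])
    (auto simp: complex_linear_def scaleC_add_right scaleC_scaleC mult.commute)

lemma blinfun_apply_scaleC:
  fixes T :: "'a::real_normed_vector \<Rightarrow>\<^sub>L 'b::complex_normed_vector"
  shows "blinfun_apply (Blinfun (\<lambda>x. c *\<^sub>C blinfun_apply T x)) = (\<lambda>x. c *\<^sub>C blinfun_apply T x)"
  by (intro bounded_linear_Blinfun_apply bounded_linear_compose[OF bounded_linear_scaleC]
      blinfun.bounded_linear_right)

lemma compact_operator_zero: "compact_operator (\<lambda>x. 0)"
  by (auto simp: compact_operator_def complex_linear_def image_constant_conv)

lemma compact_operator_limit:
  fixes T :: "'a::complex_normed_vector \<Rightarrow>\<^sub>L 'b::{complex_normed_vector, complete_space}"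
  assumes approx: "\<And>e. e > 0 \<Longrightarrow> \<exists>S. compact_operator (blinfun_apply S) \<and> norm (T - S) < e"
  shows "compact_operator (blinfun_apply T)"
proof -
  have "T (c *\<^sub>C x) = c *\<^sub>C T x" for c x
  proof -
    have "norm (T (c *\<^sub>C x) - c *\<^sub>C T x) \<le> 0 + e" if "e > 0" for e
    proof -
      define d where "d = e / (2 * (cmod c * norm x) + 1)"
      have pos: "2 * (cmod c * norm x) + 1 > 0" by (simp add: add_nonneg_pos)
      then have "d > 0" using that by (simp add: d_def)
      then obtain S where S: "compact_operator (blinfun_apply S)" "norm (T - S) < d"
        using approx by blast
      have "T (c *\<^sub>C x) - c *\<^sub>C T x = (T - S) (c *\<^sub>C x) - c *\<^sub>C (T - S) x"
        using S(1) by (simp add: blinfun.diff_left compact_operator_def complex_linear_def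
            complex_vector.scale_right_diff_distrib)
      also have "norm \<dots> \<le> norm (T - S) * (cmod c * norm x) + cmod c * (norm (T - S) * norm x)"
        using norm_blinfun[of "T - S" "c *\<^sub>C x"] norm_blinfun[of "T - S" x]
        by (intro order_trans[OF norm_triangle_ineq4] add_mono)
          (auto simp: norm_scaleC intro!: mult_left_mono)
      also have "\<dots> = norm (T - S) * (2 * (cmod c * norm x))"
        by (simp add: algebra_simps)
      also have "\<dots> \<le> d * (2 * (cmod c * norm x))"
        using S(2) by (intro mult_right_mono) auto
      also have "\<dots> \<le> d * (2 * (cmod c * norm x) + 1)"
        using \<open>d > 0\<close> by (intro mult_left_mono) auto
      also have "\<dots> = e" using pos by (simp add: d_def)
      finally show ?thesis by simp
    qed
    then have "norm (T (c *\<^sub>C x) - c *\<^sub>C T x) \<le> 0" by (rule field_le_epsilon)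
    then show ?thesis by simp
  qed
  then have lin: "complex_linear (blinfun_apply T)"
    by (simp add: complex_linear_def blinfun.add_right)
  have "\<exists>k. finite k \<and> k \<subseteq> T ` cball 0 1 \<and> T ` cball 0 1 \<subseteq> (\<Union>x\<in>k. ball x e)"
    if "e > 0" for e
  proof -
    obtain S where S: "compact_operator (blinfun_apply S)" "norm (T - S) < e/3"
      using approx[of "e/3"] \<open>e > 0\<close> by auto
    then obtain k where "finite k" "k \<subseteq> S ` cball 0 1" "S ` cball 0 1 \<subseteq> (\<Union>x\<in>k. ball x (e/3))"
      using \<open>e > 0\<close> unfolding compact_operator_def compact_closure_iff_nets
      by (meson divide_pos_pos zero_less_numeral)
    then obtain l where l: "finite l" "l \<subseteq> cball 0 1" "S ` cball 0 1 \<subseteq> (\<Union>x\<in>S ` l. ball x (e/3))"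
      by (metis finite_subset_image)
    have close: "dist (T x) (S x) < e/3" if "x \<in> cball 0 1" for x
    proof -
      have "dist (T x) (S x) \<le> norm (T - S) * norm x"
        using norm_blinfun[of "T - S" x] by (simp add: dist_norm blinfun.diff_left)
      also have "\<dots> \<le> norm (T - S)" using that by (simp add: mult_left_le)
      finally show ?thesis using S by simp
    qed
    have "T ` cball 0 1 \<subseteq> (\<Union>x\<in>T ` l. ball x e)"
    proof
      fix y assume "y \<in> T ` cball 0 1"
      then obtain x where x: "x \<in> cball 0 1" "y = T x" by blast
      then obtain z where z: "z \<in> l" "dist (S z) (S x) < e/3" using l(3) by fastforce
      have "dist (T z) (T x) \<le> dist (T z) (S z) + dist (S z) (S x) + dist (S x) (T x)"
        by (metis add_right_mono dist_triangle dist_triangle_le order_trans)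
      then have "dist (T z) (T x) < e"
        using z close[of z] close[of x] l x by (auto simp: dist_commute)
      then show "y \<in> (\<Union>x\<in>T ` l. ball x e)" using z x by auto
    qed
    then show ?thesis using l by (intro exI[of _ "T ` l"]) auto
  qed
  then show ?thesis using lin by (simp add: compact_operator_def compact_closure_iff_nets)
qed

text \<open>
  \<open>'h \<Rightarrow>\<^sub>L 'h\<close> consists of the bounded real-linear maps; complex linearity is part of
  \<^const>\<open>compact_operator\<close>. The norm is the operator norm, the product is composition.
\<close>

typedef (overloaded) 'h compact_op =
    "{T :: 'h::complex_hilbert \<Rightarrow>\<^sub>L 'h. compact_operator (blinfun_apply T)}"
  morphisms op_of Compact_Op
  by (rule exI[of _ 0]) (simp add: compact_operator_zero zero_blinfun.rep_eq)

setup_lifting type_definition_compact_op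

lemma complex_linear_op_of: "complex_linear (blinfun_apply (op_of T))"
  using op_of[of T] by (simp add: compact_operator_def)

instantiation compact_op :: (complex_hilbert) complex_vector
begin

lift_definition zero_compact_op :: "'a compact_op" is 0
  by (simp add: compact_operator_zero zero_blinfun.rep_eq)

lift_definition plus_compact_op :: "'a compact_op \<Rightarrow> 'a compact_op \<Rightarrow> 'a compact_op" is "(+)"
  by (simp add: compact_operator_add plus_blinfun.rep_eq)

lift_definition uminus_compact_op :: "'a compact_op \<Rightarrow> 'a compact_op" is uminus
  using compact_operator_scaleC[of _ "-1"] by (simp add: uminus_blinfun.rep_eq)

lift_definition minus_compact_op :: "'a compact_op \<Rightarrow> 'a compact_op \<Rightarrow> 'a compact_op" is "(-)"
  subgoal for S T
    using compact_operator_add[of S "\<lambda>x. - 1 *\<^sub>C T x"] compact_operator_scaleC[of T "-1"]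
    by (simp add: minus_blinfun.rep_eq)
  done

lift_definition scaleR_compact_op :: "real \<Rightarrow> 'a compact_op \<Rightarrow> 'a compact_op" is "scaleR"
  using compact_operator_scaleC by (simp add: scaleR_blinfun.rep_eq scaleR_scaleC)

lift_definition scaleC_compact_op :: "complex \<Rightarrow> 'a compact_op \<Rightarrow> 'a compact_op"
  is "\<lambda>c T. Blinfun (\<lambda>x. c *\<^sub>C blinfun_apply T x)"
  by (simp add: compact_operator_scaleC blinfun_apply_scaleC)

lemma op_of_scaleC: "op_of (c *\<^sub>C T) x = c *\<^sub>C op_of T x"
  by (simp add: scaleC_compact_op.rep_eq blinfun_apply_scaleC)

lemma compact_op_eqI: "(\<And>x. op_of S x = op_of T x) \<Longrightarrow> S = T"
  by (meson blinfun_eqI op_of_inject)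

instance
proof
  fix S T U :: "'a compact_op" and r q :: real and c d :: complex
  show "S + T + U = S + (T + U)" "S + T = T + S" "0 + S = S" "- S + S = 0" "S - T = S + - T"
    "r *\<^sub>R (S + T) = r *\<^sub>R S + r *\<^sub>R T" "(r + q) *\<^sub>R S = r *\<^sub>R S + q *\<^sub>R S"
    "r *\<^sub>R q *\<^sub>R S = (r * q) *\<^sub>R S" "1 *\<^sub>R S = S"
    by (transfer; simp add: algebra_simps)+
  show "c *\<^sub>C (S + T) = c *\<^sub>C S + c *\<^sub>C T" "(c + d) *\<^sub>C S = c *\<^sub>C S + d *\<^sub>C S"
    "c *\<^sub>C d *\<^sub>C S = (c * d) *\<^sub>C S" "1 *\<^sub>C S = S" "r *\<^sub>R S = complex_of_real r *\<^sub>C S"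
    by (auto intro!: compact_op_eqI
        simp: op_of_scaleC plus_compact_op.rep_eq scaleR_compact_op.rep_eq blinfun.add_left
          blinfun.scaleR_left scaleC_add_right scaleC_add_left scaleC_scaleC scaleC_one scaleR_scaleC)
qed

end

instantiation compact_op :: (complex_hilbert) complex_normed_vector
begin

lift_definition norm_compact_op :: "'a compact_op \<Rightarrow> real" is norm .

definition dist_compact_op :: "'a compact_op \<Rightarrow> 'a compact_op \<Rightarrow> real"
  where "dist_compact_op S T = norm (S - T)"

definition sgn_compact_op :: "'a compact_op \<Rightarrow> 'a compact_op"
  where "sgn_compact_op S = inverse (norm S) *\<^sub>R S"

definition [code del]:
  "(uniformity :: ('a compact_op \<times> 'a compact_op) filter) =
    (INF e\<in>{0 <..}. principal {(x, y). dist x y < e})"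

definition open_compact_op :: "'a compact_op set \<Rightarrow> bool"
  where [code del]: "open_compact_op S = (\<forall>x\<in>S. \<forall>\<^sub>F (x', y) in uniformity. x' = x \<longrightarrow> y \<in> S)"

instance
proof
  fix S T :: "'a compact_op" and r :: real and c :: complex
  show "norm (S + T) \<le> norm S + norm T" by transfer (rule norm_triangle_ineq)
  show "norm (r *\<^sub>R S) = \<bar>r\<bar> * norm S" by transfer simp
  show "(norm S = 0) = (S = 0)" by transfer simp
  have nonneg: "0 \<le> norm S" for S :: "'a compact_op" by transfer simp
  have le: "norm (c *\<^sub>C S) \<le> cmod c * norm S" for c and S :: "'a compact_op"
    unfolding norm_compact_op.rep_eq
  proof (rule norm_blinfun_bound)
    show "norm (op_of (c *\<^sub>C S) x) \<le> cmod c * norm (op_of S) * norm x" for x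
      using norm_blinfun[of "op_of S" x]
      by (simp add: op_of_scaleC norm_scaleC mult.assoc mult_left_mono)
  qed simp
  show "norm (c *\<^sub>C S) = cmod c * norm S"
  proof (cases "c = 0")
    case True
    then show ?thesis using le[of 0 S] nonneg[of "0 *\<^sub>C S"] by (simp only: norm_zero mult_zero_left)
  next
    case False
    have "norm S = norm (inverse c *\<^sub>C c *\<^sub>C S)"
      using False by (simp add: scaleC_scaleC scaleC_one)
    also have "\<dots> \<le> inverse (cmod c) * norm (c *\<^sub>C S)"
      using le[of "inverse c" "c *\<^sub>C S"] by (simp add: norm_inverse)
    finally have "cmod c * norm S \<le> norm (c *\<^sub>C S)"
      using False by (simp add: field_simps)
    then show ?thesis using le[of c S] by simp
  qed
qed (rule dist_compact_op_def sgn_compact_op_def uniformity_compact_op_def open_compact_op_def)+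

end

lemma compact_operator_compose_right:
  fixes T S :: "'a::complex_hilbert \<Rightarrow>\<^sub>L 'a"
  assumes "compact_operator (blinfun_apply T)" "complex_linear (blinfun_apply S)"
  shows "compact_operator (\<lambda>x. T (S x))"
proof -
  define r where "r = norm S + 1"
  have r: "r > 0" "norm S \<le> r" by (simp_all add: r_def add_nonneg_pos)
  have "compact_operator (\<lambda>x. complex_of_real r *\<^sub>C T x)"
    by (rule compact_operator_scaleC[OF assms(1)])
  then have cpt: "compact (closure ((\<lambda>x. r *\<^sub>R T x) ` cball 0 1))"
    by (simp add: compact_operator_def scaleR_scaleC)
  have "(\<lambda>x. T (S x)) ` cball 0 1 \<subseteq> (\<lambda>x. r *\<^sub>R T x) ` cball 0 1"
  proof clarify
    fix x :: 'a assume x: "x \<in> cball 0 1"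
    have "norm (S x) \<le> norm S * norm x" by (rule norm_blinfun)
    also have "\<dots> \<le> norm S" using x by (simp add: mult_left_le)
    finally have "norm (S x) \<le> r" using r by simp
    then have "inverse r *\<^sub>R S x \<in> cball 0 1"
      using r by (simp add: field_simps)
    moreover have "T (S x) = r *\<^sub>R T (inverse r *\<^sub>R S x)"
      using r by (simp add: blinfun.scaleR_right)
    ultimately show "T (S x) \<in> (\<lambda>x. r *\<^sub>R T x) ` cball 0 1" by blast
  qed
  then have "compact (closure ((\<lambda>x. T (S x)) ` cball 0 1))"
    using closure_subset by (intro compact_closure_if_subset[OF cpt]) (rule order_trans)
  then show ?thesis
    using assms by (simp add: compact_operator_def complex_linear_def)
qed

lemma compact_operator_adjoint:
  fixes T S :: "'a::complex_hilbert \<Rightarrow>\<^sub>L 'a"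
  assumes T: "compact_operator (blinfun_apply T)" and S: "complex_linear (blinfun_apply S)"
    and adj: "\<And>x y. cinner (S x) y = cinner x (T y)"
  shows "compact_operator (blinfun_apply S)"
proof -
  have "\<exists>k. finite k \<and> k \<subseteq> S ` cball 0 1 \<and> S ` cball 0 1 \<subseteq> (\<Union>x\<in>k. ball x e)"
    if "e > 0" for e
  proof -
    have "compact_operator (\<lambda>x. T (S x))"
      using T S by (rule compact_operator_compose_right)
    moreover have "e\<^sup>2 / 2 > 0" using that by simp
    ultimately obtain k where "finite k" "k \<subseteq> (\<lambda>x. T (S x)) ` cball 0 1"
      "(\<lambda>x. T (S x)) ` cball 0 1 \<subseteq> (\<Union>x\<in>k. ball x (e\<^sup>2 / 2))"
      unfolding compact_operator_def compact_closure_iff_nets by meson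
    then obtain l where l: "finite l" "l \<subseteq> cball 0 1"
      "(\<lambda>x. T (S x)) ` cball 0 1 \<subseteq> (\<Union>x\<in>(\<lambda>x. T (S x)) ` l. ball x (e\<^sup>2 / 2))"
      by (metis finite_subset_image)
    have "S ` cball 0 1 \<subseteq> (\<Union>x\<in>S ` l. ball x e)"
    proof clarify
      fix x :: 'a assume x: "x \<in> cball 0 1"
      then have "T (S x) \<in> (\<Union>x\<in>(\<lambda>x. T (S x)) ` l. ball x (e\<^sup>2 / 2))"
        using l(3) by blast
      then obtain z where z: "z \<in> l" "dist (T (S z)) (T (S x)) < e\<^sup>2 / 2"
        by auto
      have "complex_of_real ((norm (S (z - x)))\<^sup>2) = cinner (z - x) (T (S (z - x)))"
        using adj[of "z - x" "S (z - x)"] by (simp only: cinner_self)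
      then have "(norm (S (z - x)))\<^sup>2 = cmod (cinner (z - x) (T (S (z - x))))"
        by (metis abs_of_nonneg norm_of_real zero_le_power2)
      also have "\<dots> \<le> norm (z - x) * norm (T (S (z - x)))"
        by (rule cmod_cinner_le)
      also have "\<dots> \<le> 2 * norm (T (S (z - x)))"
        using norm_triangle_ineq4[of z x] x z l(2) by (intro mult_right_mono) force+
      also have "\<dots> < e\<^sup>2"
        using z(2) by (simp add: dist_norm blinfun.diff_right)
      finally have "dist (S z) (S x) < e"
        using that by (simp add: dist_norm blinfun.diff_right power_less_imp_less_base)
      then show "S x \<in> (\<Union>x\<in>S ` l. ball x e)" using z(1) by auto
    qed
    then show ?thesis using l by (intro exI[of _ "S ` l"]) auto
  qed
  then show ?thesis using S by (simp add: compact_operator_def compact_closure_iff_nets)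
qed

lemma ex_adjoint_compact_op:
  "\<exists>S :: 'a::complex_hilbert compact_op. \<forall>x y. cinner (op_of S x) y = cinner x (op_of T y)"
proof -
  obtain S :: "'a \<Rightarrow>\<^sub>L 'a" where S: "complex_linear (blinfun_apply S)"
    "\<And>x y. cinner (S x) y = cinner x (op_of T y)"
    using ex_adjoint complex_linear_op_of by blast
  have "compact_operator (blinfun_apply S)"
    using compact_operator_adjoint[of "op_of T" S] S op_of[of T] by simp
  then show ?thesis
    using S(2) by (intro exI[of _ "Compact_Op S"]) (simp add: Compact_Op_inverse)
qed

instantiation compact_op :: (complex_hilbert) cstar_algebra
begin

lift_definition times_compact_op :: "'a compact_op \<Rightarrow> 'a compact_op \<Rightarrow> 'a compact_op" is "(o\<^sub>L)"
  subgoal for S T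
    using compact_operator_compose_right[of S T]
    by (simp add: compact_operator_def blinfun_compose.rep_eq o_def)
  done

definition adj_compact_op :: "'a compact_op \<Rightarrow> 'a compact_op"
  where "adj_compact_op T = (SOME S. \<forall>x y. cinner (op_of S x) y = cinner x (op_of T y))"

lemma op_of_times: "op_of (S * T) x = op_of S (op_of T x)"
  by (simp add: times_compact_op.rep_eq)

lemma cinner_adj: "cinner (op_of (adj T) x) y = cinner x (op_of T y)"
  using someI_ex[OF ex_adjoint_compact_op[of T]] unfolding adj_compact_op_def by blast

lemma cinner_adj': "cinner x (op_of (adj T) y) = cinner (op_of T x) y"
  by (metis cinner_adj cinner_commute)

instance
proof
  fix S T U :: "'a compact_op" and r :: real and c :: complex
  show "S * T * U = S * (T * U)"
    by (auto intro!: compact_op_eqI simp: op_of_times)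
  show "(S + T) * U = S * U + T * U" "S * (T + U) = S * T + S * U"
    "(r *\<^sub>R S) * T = r *\<^sub>R (S * T)" "S * (r *\<^sub>R T) = r *\<^sub>R (S * T)"
    by (auto intro!: compact_op_eqI simp: op_of_times plus_compact_op.rep_eq scaleR_compact_op.rep_eq
        blinfun.add_left blinfun.add_right blinfun.scaleR_left blinfun.scaleR_right)
  show "norm (S * T) \<le> norm S * norm T"
    by transfer (rule norm_blinfun_compose)
  show "(c *\<^sub>C S) * T = c *\<^sub>C (S * T)" "S * (c *\<^sub>C T) = c *\<^sub>C (S * T)"
    using complex_linear_op_of[of S]
    by (auto intro!: compact_op_eqI simp: op_of_times op_of_scaleC complex_linear_def)
  show "adj (adj S) = S"
    by (intro compact_op_eqI cinner_extensionality) (simp add: cinner_adj cinner_adj')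
  show "adj (S + T) = adj S + adj T"
    by (intro compact_op_eqI cinner_extensionality)
      (simp add: cinner_adj' plus_compact_op.rep_eq blinfun.add_left cinner_add_left cinner_add_right)
  show "adj (c *\<^sub>C S) = cnj c *\<^sub>C adj S"
    by (intro compact_op_eqI cinner_extensionality)
      (simp add: cinner_adj' op_of_scaleC cinner_scaleC_left cinner_scaleC_right)
  show "adj (S * T) = adj T * adj S"
    by (intro compact_op_eqI cinner_extensionality) (simp add: cinner_adj' op_of_times)
  have square_le: "(norm S)\<^sup>2 \<le> norm (adj S * S)" for S :: "'a compact_op"
  proof -
    have "norm (op_of S x) \<le> sqrt (norm (adj S * S)) * norm x" for x
    proof (rule power2_le_imp_le)
      have "complex_of_real ((norm (op_of S x))\<^sup>2) = cinner x (op_of (adj S * S) x)"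
        using cinner_self[of "op_of S x"] by (simp only: op_of_times cinner_adj')
      then have "(norm (op_of S x))\<^sup>2 = cmod (cinner x (op_of (adj S * S) x))"
        by (metis abs_of_nonneg norm_of_real zero_le_power2)
      also have "\<dots> \<le> norm x * (norm (op_of (adj S * S)) * norm x)"
        by (intro order_trans[OF cmod_cinner_le] mult_left_mono norm_blinfun) simp
      finally show "(norm (op_of S x))\<^sup>2 \<le> (sqrt (norm (adj S * S)) * norm x)\<^sup>2"
        by (simp add: power_mult_distrib norm_compact_op.rep_eq power2_eq_square mult_ac)
    qed simp
    then have "norm S \<le> sqrt (norm (adj S * S))"
      unfolding norm_compact_op.rep_eq[of S] by (intro norm_blinfun_bound) simp_all
    then have "(norm S)\<^sup>2 \<le> (sqrt (norm (adj S * S)))\<^sup>2"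
      by (intro power_mono) simp_all
    then show ?thesis by simp
  qed
  have mult_le: "norm (S * T) \<le> norm S * norm T" for S T :: "'a compact_op"
    by transfer (rule norm_blinfun_compose)
  have norm_le_adj: "norm S \<le> norm (adj S)" for S :: "'a compact_op"
  proof (cases "norm S = 0")
    case False
    have "norm S * norm S \<le> norm (adj S) * norm S"
      using square_le[of S] mult_le[of "adj S" S] by (simp add: power2_eq_square)
    then show ?thesis using False by simp
  qed simp
  have "norm (adj S) \<le> norm S"
    using norm_le_adj[of "adj S"] \<open>adj (adj S) = S\<close> by simp
  then have "norm (adj S * S) \<le> (norm S)\<^sup>2"
    using mult_le[of "adj S" S] mult_right_mono[of "norm (adj S)" "norm S" "norm S"]
    by (simp add: power2_eq_square)
  then show "norm (adj S * S) = (norm S)\<^sup>2"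
    using square_le[of S] by simp
next
  fix X :: "nat \<Rightarrow> 'a compact_op" assume "Cauchy X"
  have dist_op_of: "dist (op_of S) (op_of T) = dist S T" for S T :: "'a compact_op"
    by (simp add: dist_norm norm_compact_op.rep_eq minus_compact_op.rep_eq)
  have "Cauchy (\<lambda>n. op_of (X n))"
    using \<open>Cauchy X\<close> by (simp add: Cauchy_def dist_op_of)
  then obtain L where L: "(\<lambda>n. op_of (X n)) \<longlonglongrightarrow> L"
    using Cauchy_convergent_iff convergent_def by blast
  have "compact_operator (blinfun_apply L)"
  proof (rule compact_operator_limit)
    fix e :: real assume "e > 0"
    then obtain n where "dist (op_of (X n)) L < e"
      using L unfolding lim_sequentially by blast
    then show "\<exists>S. compact_operator (blinfun_apply S) \<and> norm (L - S) < e"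
      using op_of[of "X n"] by (intro exI[of _ "op_of (X n)"]) (simp add: dist_norm norm_minus_commute)
  qed
  then have "op_of (Compact_Op L) = L" by (simp add: Compact_Op_inverse)
  then have "X \<longlonglongrightarrow> Compact_Op L"
    using L dist_op_of[of _ "Compact_Op L"] by (simp add: lim_sequentially)
  then show "convergent X" by (auto simp: convergent_def)
qed

end

end

theory Submission
  imports Defs
begin

text \<open>
  Let \<open>b\<close> be an orthonormal basis of the Hilbert space. Multiplication on the left by the isometries
  \<open>b i \<mapsto> b (2 i + 1)\<close> and \<open>b i \<mapsto> b (2 i)\<close> gives maps of the compact operators which extend to maps
  \<open>L\<close> and \<open>M\<close> of the tensor product with \<open>(L x)\<^sup>* (L y) = x\<^sup>* y = (M x)\<^sup>* (M y)\<close> and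
  \<open>(L x)\<^sup>* (M y) = 0\<close>. The Cayley transforms \<open>(a - L) (1 - a L)\<^sup>-\<^sup>1\<close>, \<open>0 \<le> a < 1\<close>, also preserve
  \<open>x\<^sup>* y\<close>. As \<open>L\<close> is mean ergodic with limit \<open>0\<close>, the range of \<open>1 - L\<close> is dense, so they converge
  strongly to \<open>1\<close> for \<open>a \<rightarrow> 1\<close>. This deforms the identity of
  \<open>{V. V\<^sup>* V = P}\<close> to \<open>V \<mapsto> - L V\<close>, and \<open>sin s \<cdot> M P - cos s \<cdot> L V\<close> deforms that to the constant \<open>M P\<close>.
\<close>

section \<open>Extension by density\<close>

lemma subspace_closure:
  fixes S :: "'a::real_normed_vector set"
  assumes "subspace S"
  shows "subspace (closure S)"
proof (rule subspaceI)
  show "0 \<in> closure S"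
    using assms closure_subset subspace_0 by blast
next
  fix x y assume "x \<in> closure S" "y \<in> closure S"
  then obtain f g where "\<And>n. f n \<in> S" "f \<longlonglongrightarrow> x" "\<And>n. g n \<in> S" "g \<longlonglongrightarrow> y"
    unfolding closure_sequential by blast
  then show "x + y \<in> closure S"
    unfolding closure_sequential
    by (intro exI[of _ "\<lambda>n. f n + g n"]) (auto intro: tendsto_add subspace_add[OF assms])
next
  fix c :: real and x assume "x \<in> closure S"
  then obtain f where "\<And>n. f n \<in> S" "f \<longlonglongrightarrow> x"
    unfolding closure_sequential by blast
  then show "c *\<^sub>R x \<in> closure S"
    unfolding closure_sequential
    by (intro exI[of _ "\<lambda>n. c *\<^sub>R f n"]) (auto intro: tendsto_scaleR subspace_scale[OF assms])
qed

lemma closed_subspace_eq_UNIV: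
  assumes "closure (span X) = UNIV" "closed S" "subspace S" "X \<subseteq> S"
  shows "S = UNIV"
  using closure_minimal[OF span_minimal[OF assms(4,3)] assms(2)] assms(1) by auto

lemma bounded_linear_eq_on_dense:
  assumes "bounded_linear f" "bounded_linear g" "closure (span X) = UNIV"
    and "\<And>x. x \<in> X \<Longrightarrow> f x = g x"
  shows "f x = g x"
proof -
  interpret f: bounded_linear f by fact
  interpret g: bounded_linear g by fact
  have "{x. f x = g x} = UNIV"
  proof (rule closed_subspace_eq_UNIV[OF assms(3)])
    show "closed {x. f x = g x}"
      by (intro closed_Collect_eq f.continuous_on g.continuous_on continuous_on_id)
    show "subspace {x. f x = g x}"
      by (rule subspaceI) (simp_all add: f.zero g.zero f.add g.add f.scaleR g.scaleR)
  qed (use assms(4) in auto)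
  then show ?thesis by blast
qed

lemma bounded_bilinear_eq_on_dense:
  assumes "bounded_bilinear f" "bounded_bilinear g"
    and "closure (span X) = UNIV" "closure (span Y) = UNIV"
    and "\<And>x y. x \<in> X \<Longrightarrow> y \<in> Y \<Longrightarrow> f x y = g x y"
  shows "f x y = g x y"
proof -
  interpret f: bounded_bilinear f by fact
  interpret g: bounded_bilinear g by fact
  have "f x y = g x y" if "x \<in> X" for x y
    by (rule bounded_linear_eq_on_dense[OF f.bounded_linear_right g.bounded_linear_right assms(4)])
      (use assms(5) that in auto)
  then show ?thesis
    by (rule bounded_linear_eq_on_dense[OF f.bounded_linear_left g.bounded_linear_left assms(3)])
qed

text \<open>The graph of the extension is the closure of \<open>G\<close>.\<close>

lemma isometry_extension:
  fixes G :: "('a::real_normed_vector \<times> 'b::banach) set"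
  assumes G: "subspace G" and norm: "\<And>x y. (x, y) \<in> G \<Longrightarrow> norm y = norm x"
    and dense: "closure (fst ` G) = UNIV"
  shows "\<exists>L. bounded_linear L \<and> (\<forall>x. norm (L x) = norm x) \<and> (\<forall>x y. (x, y) \<in> G \<longrightarrow> L x = y)"
proof -
  have sub: "subspace (closure G)" by (rule subspace_closure[OF G])
  have "G \<subseteq> {p. norm (snd p) = norm (fst p)}" using norm by auto
  then have "closure G \<subseteq> {p. norm (snd p) = norm (fst p)}"
    by (intro closure_minimal closed_Collect_eq continuous_intros)
  then have norm': "norm y = norm x" if "(x, y) \<in> closure G" for x y
    using that by auto
  have ex: "\<exists>y. (x, y) \<in> closure G" for x
  proof -
    have "x \<in> closure (fst ` G)" using dense by simp
    then obtain f where f: "\<And>n. f n \<in> fst ` G" "f \<longlonglongrightarrow> x"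
      unfolding closure_sequential by blast
    then have "\<exists>y. (f n, y) \<in> G" for n by (metis fst_conv imageE prod.collapse)
    then obtain g where g: "\<And>n. (f n, g n) \<in> G" by metis
    \<comment> \<open>Differences of pairs of the subspace \<open>G\<close> stay in
      \<open>G\<close>, so \<open>norm\<close> applies to them and carries the Cauchy property of
      \<open>f\<close> over to \<open>g\<close>.\<close>
    have "dist (g m) (g n) = dist (f m) (f n)" for m n
      using norm[of "f m - f n" "g m - g n"] subspace_diff[OF G g[of m] g[of n]]
      by (simp add: dist_norm)
    moreover have "Cauchy f" using f(2) by (rule LIMSEQ_imp_Cauchy)
    ultimately have "Cauchy g" by (simp add: Cauchy_def)
    then obtain y where "g \<longlonglongrightarrow> y"
      using Cauchy_convergent_iff convergent_def by blast
    then have "(\<lambda>n. (f n, g n)) \<longlonglongrightarrow> (x, y)" using f(2) by (intro tendsto_Pair)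
    moreover have "\<forall>n. (f n, g n) \<in> G" using g by blast
    ultimately show ?thesis
      unfolding closure_sequential
      by (intro exI[of _ y] exI[of _ "\<lambda>n. (f n, g n)"] conjI)
  qed
  then obtain L where L: "\<And>x. (x, L x) \<in> closure G" by metis
  \<comment> \<open>Two values over the same \<open>x\<close> differ by a \<open>v\<close> with
    \<open>(0, v)\<close> in \<open>closure G\<close>, and such a \<open>v\<close> has norm
    \<open>0\<close>. Linearity of \<open>L\<close> follows because the closure is a
    subspace.\<close>
  have unique: "L x = y" if "(x, y) \<in> closure G" for x y
    using norm'[of 0 "L x - y"] subspace_diff[OF sub L[of x] that] by simp
  have "bounded_linear L"
  proof (rule bounded_linear_intro)
    show "L (x + y) = L x + L y" for x y
      using subspace_add[OF sub L[of x] L[of y]] by (intro unique) simp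
    show "L (c *\<^sub>R x) = c *\<^sub>R L x" for c x
      using subspace_scale[OF sub L[of x], of c] by (intro unique) simp
    show "norm (L x) \<le> norm x * 1" for x
      using norm'[OF L[of x]] by simp
  qed
  then show ?thesis
    using norm'[OF L] unique[OF closure_subset[THEN subsetD]] by (intro exI[of _ L] conjI allI impI)
qed

section \<open>Isometries of a separable Hilbert space\<close>

lemma bounded_bilinear_cinner: "bounded_bilinear (cinner :: 'a::complex_inner \<Rightarrow> _)"
proof
  show "\<exists>K. \<forall>a b. norm (cinner a b :: complex) \<le> norm (a::'a) * norm (b::'a) * K"
    by (rule exI[of _ 1]) (simp add: cmod_cinner_le)
qed (simp_all add: cinner_add_left cinner_add_right cinner_scaleR_left cinner_scaleR_right scaleR_conv_of_real)

lemma bilinear_if_bounded_bilinear: "bounded_bilinear f \<Longrightarrow> bilinear f"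
  unfolding bilinear_def
  by (blast intro: bounded_linear.linear bounded_bilinear.bounded_linear_left
      bounded_bilinear.bounded_linear_right)

definition orthonormal :: "('i \<Rightarrow> 'a::complex_inner) \<Rightarrow> bool"
  where "orthonormal b \<longleftrightarrow> (\<forall>i j. cinner (b i) (b j) = (if i = j then 1 else 0))"

text \<open>This lets the real notions \<open>span\<close>, \<open>subspace\<close> and
  \<open>bounded_linear\<close> of the analysis library serve complex spans: the generators merely
  have to be closed under complex multiples.\<close>

lemma span_scaleC_multiples:
  "span {c *\<^sub>C x |c x. x \<in> X} = complex_vector.span X" for X :: "'a::complex_vector set"
proof
  have "subspace (complex_vector.span X)"
    by (auto intro!: subspaceI simp: scaleR_scaleC
        intro: complex_vector.span_zero complex_vector.span_add complex_vector.span_scale)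
  then show "span {c *\<^sub>C x |c x. x \<in> X} \<subseteq> complex_vector.span X"
    by (intro span_minimal) (auto intro: complex_vector.span_scale complex_vector.span_base)
next
  let ?S = "span {c *\<^sub>C x |c x. x \<in> X}"
  have scale: "d *\<^sub>C y \<in> ?S" if "y \<in> ?S" for d y
    using that
  proof (induction rule: span_induct)
    case base
    have "d *\<^sub>C (r *\<^sub>R x) = r *\<^sub>R (d *\<^sub>C x)" for r and x :: 'a
      by (simp add: scaleR_scaleC scaleC_scaleC mult.commute)
    then show ?case
      by (intro subspaceI) (auto simp: scaleC_add_right span_zero span_add span_scale)
  next
    case (step x)
    then obtain c x' where "x' \<in> X" "x = c *\<^sub>C x'" by blast
    then have "x' \<in> X" "d *\<^sub>C x = (d * c) *\<^sub>C x'" by (simp_all only: scaleC_scaleC)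
    then show ?case by (intro span_base) blast
  qed
  have "complex_vector.subspace ?S"
    by (rule complex_vector.subspaceI) (auto intro: span_zero span_add scale)
  moreover have "X \<subseteq> ?S"
  proof
    fix x assume "x \<in> X"
    then have "1 *\<^sub>C x \<in> ?S" by (intro span_base) blast
    then show "x \<in> ?S" by (simp add: scaleC_one)
  qed
  ultimately show "complex_vector.span X \<subseteq> ?S"
    by (intro complex_vector.span_minimal)
qed

text \<open>The pairs \<open>(c *\<^sub>C b i, c *\<^sub>C d i)\<close> generate the graph. By
  orthonormality both components have the same inner products on generators, hence on the real span
  by bilinearity, so the graph is isometric. Complex linearity is then checked on the multiples of
  the \<open>b i\<close>, which have dense real span.\<close>

lemma complex_linear_isometry_extension:
  fixes b d :: "'i \<Rightarrow> 'h::complex_hilbert"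
  assumes b: "orthonormal b" "closure (complex_vector.span (range b)) = UNIV" and d: "orthonormal d"
  shows "\<exists>W. bounded_linear W \<and> complex_linear W \<and>
    (\<forall>x y. cinner (W x) (W y) = cinner x y) \<and> (\<forall>i. W (b i) = d i)"
proof -
  define X where "X = {c *\<^sub>C b i |c i. True}"
  define E where "E = {(c *\<^sub>C b i, c *\<^sub>C d i) |c i. True}"
  have X: "closure (span X) = UNIV"
  proof -
    have "X = {c *\<^sub>C x |c x. x \<in> range b}" unfolding X_def by blast
    then show ?thesis using b(2) by (simp add: span_scaleC_multiples)
  qed
  have "fst ` E = X"
  proof
    show "fst ` E \<subseteq> X"
      unfolding E_def X_def by (rule image_subsetI) (clarsimp, blast)
    show "X \<subseteq> fst ` E"
    proof
      fix x assume "x \<in> X"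
      then obtain c i where "x = c *\<^sub>C b i" unfolding X_def by blast
      then have "(x, c *\<^sub>C d i) \<in> E" unfolding E_def by blast
      then show "x \<in> fst ` E" by (rule image_eqI[rotated]) simp
    qed
  qed
  then have dense: "closure (fst ` span E) = UNIV"
    using X linear_span_image[OF linear_fst, of E] by metis
  have norm: "norm y = norm x" if "(x, y) \<in> span E" for x y
  proof -
    have "cinner (snd p) (snd q) = cinner (fst p) (fst q)" if "p \<in> span E" "q \<in> span E" for p q
    proof (rule bilinear_eq[of "\<lambda>p q. cinner (snd p) (snd q)" "\<lambda>p q. cinner (fst p) (fst q)"
          "span E" E "span E" E])
      show "bilinear (\<lambda>(p :: 'h \<times> 'h) (q :: 'h \<times> 'h). cinner (snd p) (snd q))"
        using bounded_bilinear.comp[OF bounded_bilinear_cinner bounded_linear_snd bounded_linear_snd]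
        by (rule bilinear_if_bounded_bilinear)
      show "bilinear (\<lambda>(p :: 'h \<times> 'h) (q :: 'h \<times> 'h). cinner (fst p) (fst q))"
        using bounded_bilinear.comp[OF bounded_bilinear_cinner bounded_linear_fst bounded_linear_fst]
        by (rule bilinear_if_bounded_bilinear)
      show "cinner (snd p) (snd q) = cinner (fst p) (fst q)" if "p \<in> E" "q \<in> E" for p q
        using that b(1) d unfolding E_def orthonormal_def
        by (auto simp: cinner_scaleC_left cinner_scaleC_right)
    qed (use that in auto)
    from this[OF that that] have "complex_of_real ((norm y)\<^sup>2) = complex_of_real ((norm x)\<^sup>2)"
      by (simp only: cinner_self fst_conv snd_conv)
    then show ?thesis by (simp only: of_real_eq_iff) simp
  qed
  obtain W where W: "bounded_linear W" "\<And>x. norm (W x) = norm x"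
      "\<And>x y. (x, y) \<in> span E \<Longrightarrow> W x = y"
    using isometry_extension[OF subspace_span norm dense] by blast
  have Wb: "W (c *\<^sub>C b i) = c *\<^sub>C d i" for c i
    by (rule W(3)[OF span_base]) (unfold E_def, blast)
  have "W (c *\<^sub>C x) = c *\<^sub>C W x" for c x
  proof (rule bounded_linear_eq_on_dense[of "\<lambda>x. W (c *\<^sub>C x)" "\<lambda>x. c *\<^sub>C W x", OF _ _ X])
    show "bounded_linear (\<lambda>x. W (c *\<^sub>C x))"
      by (rule bounded_linear_compose[OF W(1) bounded_linear_scaleC])
    show "bounded_linear (\<lambda>x. c *\<^sub>C W x)"
      by (rule bounded_linear_compose[OF bounded_linear_scaleC W(1)])
  qed (auto simp: X_def scaleC_scaleC Wb)
  then have "complex_linear W"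
    using W(1) by (auto simp: complex_linear_def bounded_linear.linear linear_add)
  moreover have "cinner (W x) (W y) = cinner x y" for x y
  proof (rule bounded_bilinear_eq_on_dense[OF _ bounded_bilinear_cinner X X])
    show "bounded_bilinear (\<lambda>x y. cinner (W x) (W y))"
      by (rule bounded_bilinear.comp[OF bounded_bilinear_cinner W(1) W(1)])
    fix x y assume "x \<in> X" "y \<in> X"
    then show "cinner (W x) (W y) = cinner x y"
      using b(1) d unfolding X_def orthonormal_def
      by (auto simp: Wb cinner_scaleC_left cinner_scaleC_right)
  qed
  moreover have "W (b i) = d i" for i
    using Wb[of 1 i] by (simp add: scaleC_one)
  ultimately show ?thesis using W(1) by blast
qed

section \<open>Gram-Schmidt and orthonormal sequences with dense span\<close>

definition orthonormal_set :: "'a::complex_inner set \<Rightarrow> bool"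
  where "orthonormal_set E \<longleftrightarrow> (\<forall>x\<in>E. \<forall>y\<in>E. cinner x y = (if x = y then 1 else 0))"

lemma cinner_sum_right: "cinner x (\<Sum>i\<in>I. f i) = (\<Sum>i\<in>I. cinner x (f i))"
  by (rule bounded_linear.linear[OF bounded_bilinear.bounded_linear_right[OF bounded_bilinear_cinner],
        THEN linear_sum])

lemma cinner_orthonormal_set_expansion:
  assumes "finite E" "orthonormal_set E" "e \<in> E"
  shows "cinner e (\<Sum>f\<in>E. cinner f x *\<^sub>C f) = cinner e x"
proof -
  have "cinner e (\<Sum>f\<in>E. cinner f x *\<^sub>C f) = (\<Sum>f\<in>E. if f = e then cinner e x else 0)"
    unfolding cinner_sum_right
    by (rule sum.cong) (use assms in \<open>auto simp: cinner_scaleC_right orthonormal_set_def\<close>)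
  then show ?thesis using assms by simp
qed

text \<open>Subtract from \<open>d\<close> its orthogonal projection \<open>p\<close> onto the span
  of \<open>F\<close>. Either nothing remains, or the normalised remainder is the new
  vector.\<close>

lemma gram_schmidt_step:
  fixes d :: "'a::complex_inner"
  assumes F: "finite F" "orthonormal_set F"
  shows "\<exists>F'. finite F' \<and> orthonormal_set F' \<and> F \<subseteq> F' \<and> d \<in> complex_vector.span F'"
proof -
  define p where "p = (\<Sum>f\<in>F. cinner f d *\<^sub>C f)"
  define r where "r = d - p"
  have p: "p \<in> complex_vector.span F"
    unfolding p_def
    by (intro complex_vector.span_sum complex_vector.span_scale complex_vector.span_base)
  have orth: "cinner f r = 0" if "f \<in> F" for f
    using cinner_orthonormal_set_expansion[OF F that, of d]
    by (simp add: r_def p_def cinner_diff_right)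
  show ?thesis
  proof (cases "r = 0")
    case True
    then show ?thesis using F p by (auto simp: r_def)
  next
    case False
    define e where "e = inverse (norm r) *\<^sub>R r"
    have "norm e = 1" using False by (simp add: e_def)
    then have ee: "cinner e e = 1" by (simp add: cinner_self)
    have fe: "cinner f e = 0" "cinner e f = 0" if "f \<in> F" for f
    proof -
      show "cinner f e = 0" using orth[OF that] by (simp add: e_def cinner_scaleR_right)
      then show "cinner e f = 0" by (metis cinner_commute complex_cnj_zero)
    qed
    have "orthonormal_set (insert e F)"
      using F(2) ee fe unfolding orthonormal_set_def by (metis insert_iff zero_neq_one)
    moreover have "d \<in> complex_vector.span (insert e F)"
    proof -
      have "r = complex_of_real (norm r) *\<^sub>C e"
        using False by (simp add: e_def flip: scaleR_scaleC)
      then have "d = p + complex_of_real (norm r) *\<^sub>C e" by (simp add: r_def algebra_simps)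
      moreover have "p \<in> complex_vector.span (insert e F)"
        using p complex_vector.span_mono[of F "insert e F"] by blast
      ultimately show ?thesis
        by (metis complex_vector.span_add complex_vector.span_base complex_vector.span_scale insertI1)
    qed
    ultimately show ?thesis using F(1) by (intro exI[of _ "insert e F"]) auto
  qed
qed

text \<open>Gram-Schmidt runs along an enumeration of a countable dense set and yields an increasing
  chain of finite orthonormal sets. Repetitions in the enumeration are harmless, since a vector
  already in the span adds nothing.\<close>

lemma ex_countable_orthonormal_set_dense_span:
  assumes "separable_space (euclidean :: 'h::complex_inner topology)"
  shows "\<exists>E :: 'h set. countable E \<and> orthonormal_set E \<and> closure (complex_vector.span E) = UNIV"
proof -
  obtain D :: "'h set" where D: "countable D" "closure D = UNIV"
    using assms by (auto simp: separable_space_def)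
  then have "D \<noteq> {}" by auto
  have "\<exists>F :: nat \<Rightarrow> 'h set. \<forall>n. (finite (F n) \<and> orthonormal_set (F n)) \<and>
      (F n \<subseteq> F (Suc n) \<and> from_nat_into D n \<in> complex_vector.span (F (Suc n)))"
  proof (rule dependent_nat_choice)
    show "\<exists>F :: 'h set. finite F \<and> orthonormal_set F"
      by (rule exI[of _ "{}"]) (simp add: orthonormal_set_def)
    show "\<exists>F'. (finite F' \<and> orthonormal_set F') \<and> (F \<subseteq> F' \<and> from_nat_into D n \<in> complex_vector.span F')"
      if "finite F \<and> orthonormal_set F" for F and n
      using gram_schmidt_step[of F "from_nat_into D n"] that by blast
  qed
  then obtain F :: "nat \<Rightarrow> 'h set" where F: "\<And>n. finite (F n)" "\<And>n. orthonormal_set (F n)"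
    "\<And>n. F n \<subseteq> F (Suc n)" "\<And>n. from_nat_into D n \<in> complex_vector.span (F (Suc n))"
    by blast
  have mono: "F m \<subseteq> F n" if "m \<le> n" for m n
    using F(3) that by (rule lift_Suc_mono_le)
  let ?E = "\<Union>n. F n"
  have "orthonormal_set ?E"
    unfolding orthonormal_set_def
  proof (intro ballI)
    fix x y assume "x \<in> ?E" "y \<in> ?E"
    then obtain m n where "x \<in> F m" "y \<in> F n" by blast
    \<comment> \<open>The \<open>F n\<close> form a chain, so both vectors lie in one orthonormal
      set.\<close>
    then have "x \<in> F (max m n)" "y \<in> F (max m n)"
      using mono[of m "max m n"] mono[of n "max m n"] by auto
    then show "cinner x y = (if x = y then 1 else 0)"
      using F(2)[of "max m n"] unfolding orthonormal_set_def by blast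
  qed
  moreover have "countable ?E" by (simp add: F(1) countable_finite)
  moreover have "D \<subseteq> complex_vector.span ?E"
  proof
    fix d assume "d \<in> D"
    then obtain n where "d = from_nat_into D n"
      using from_nat_into_surj[OF D(1)] by metis
    then show "d \<in> complex_vector.span ?E"
      using F(4)[of n] complex_vector.span_mono[of "F (Suc n)" ?E] by blast
  qed
  then have "closure (complex_vector.span ?E) = UNIV"
    using closure_mono[of D "complex_vector.span ?E"] D(2) by auto
  ultimately show ?thesis by blast
qed

text \<open>For finite \<open>E\<close> the Fourier expansion is a bounded linear map. It is the
  identity on multiples of elements of \<open>E\<close>, hence everywhere, and its values lie in the
  span. This excludes a finite basis when the space is infinite-dimensional.\<close>

lemma span_UNIV_if_finite_orthonormal_set:
  fixes E :: "'h::complex_inner set"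
  assumes E: "finite E" "orthonormal_set E" "closure (complex_vector.span E) = UNIV"
  shows "complex_vector.span E = UNIV"
proof -
  let ?X = "{c *\<^sub>C x |c x. x \<in> E}"
  have "(\<Sum>e\<in>E. cinner e x *\<^sub>C e) = x" for x
  proof (rule bounded_linear_eq_on_dense[of "\<lambda>x. \<Sum>e\<in>E. cinner e x *\<^sub>C e" "\<lambda>x. x" ?X])
    show "bounded_linear (\<lambda>x. \<Sum>e\<in>E. cinner e x *\<^sub>C e)"
    proof (rule bounded_linear_sum)
      fix e assume "e \<in> E"
      show "bounded_linear (\<lambda>x. cinner e x *\<^sub>C e)"
      proof (rule bounded_linear_intro)
        show "norm (cinner e x *\<^sub>C e) \<le> norm x * (norm e * norm e)" for x
          using mult_right_mono[OF cmod_cinner_le[of e x] norm_ge_zero[of e]]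
          by (simp add: norm_scaleC mult_ac)
        show "cinner e (r *\<^sub>R x) *\<^sub>C e = r *\<^sub>R (cinner e x *\<^sub>C e)" for r x
          by (simp only: cinner_scaleR_right) (simp add: scaleR_scaleC scaleC_scaleC)
      qed (simp add: cinner_add_right scaleC_add_left)
    qed
    show "closure (span ?X) = UNIV" using E(3) by (simp add: span_scaleC_multiples)
    fix x assume "x \<in> ?X"
    then obtain c f where x: "x = c *\<^sub>C f" "f \<in> E" by blast
    have "(\<Sum>e\<in>E. cinner e x *\<^sub>C e) = (\<Sum>e\<in>E. if e = f then c *\<^sub>C f else 0)"
      using E(2) x by (intro sum.cong) (auto simp: orthonormal_set_def cinner_scaleC_right)
    then show "(\<Sum>e\<in>E. cinner e x *\<^sub>C e) = x" using E(1) x by simp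
  qed simp
  moreover have "(\<Sum>e\<in>E. cinner e x *\<^sub>C e) \<in> complex_vector.span E" for x
    by (intro complex_vector.span_sum complex_vector.span_scale complex_vector.span_base)
  ultimately show ?thesis by (metis UNIV_eq_I)
qed

lemma ex_orthonormal_sequence_dense_span:
  assumes "separable_space (euclidean :: 'h::complex_inner topology)"
    and "\<nexists>B :: 'h set. finite B \<and> complex_vector.span B = UNIV"
  shows "\<exists>b :: nat \<Rightarrow> 'h. orthonormal b \<and> closure (complex_vector.span (range b)) = UNIV"
proof -
  obtain E :: "'h set" where E: "countable E" "orthonormal_set E" "closure (complex_vector.span E) = UNIV"
    using ex_countable_orthonormal_set_dense_span[OF assms(1)] by blast
  have "infinite E"
  proof
    assume "finite E"
    then have "complex_vector.span E = UNIV"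
      using E(2,3) by (rule span_UNIV_if_finite_orthonormal_set)
    then show False using assms(2) \<open>finite E\<close> by (metis (full_types))
  qed
  then have bij: "bij_betw (from_nat_into E) UNIV E"
    using E(1) by (intro bij_betw_from_nat_into)
  have "from_nat_into E i \<in> E" "from_nat_into E i = from_nat_into E j \<longleftrightarrow> i = j" for i j
    using bij unfolding bij_betw_def by (auto simp: inj_eq)
  then have "orthonormal (from_nat_into E)"
    using E(2) unfolding orthonormal_def orthonormal_set_def by simp
  moreover have "range (from_nat_into E) = E" using bij by (simp add: bij_betw_def)
  ultimately show ?thesis using E(3) by (intro exI[of _ "from_nat_into E"]) simp
qed

text \<open>Pythagoras: injectivity of \<open>f\<close> makes the summands pairwise orthogonal. The
  resulting growth \<open>sqrt n\<close>, slower than \<open>n\<close>, drives the averages over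
  orthonormal orbits to \<open>0\<close>.\<close>

lemma norm_sum_orthonormal:
  assumes b: "orthonormal b" and f: "inj f"
  shows "(norm (\<Sum>j<n. b (f j)))\<^sup>2 = real n"
proof (induction n)
  case (Suc n)
  have "cinner (b (f n)) (\<Sum>j<n. b (f j)) = (\<Sum>j<n. 0)"
    unfolding cinner_sum_right
    by (rule sum.cong) (use b f in \<open>auto simp: orthonormal_def inj_eq\<close>)
  then have "cinner (\<Sum>j<n. b (f j)) (b (f n)) = 0"
    by (metis cinner_commute complex_cnj_zero sum.neutral_const)
  moreover have "(norm (b (f n)))\<^sup>2 = 1"
    using b cinner_self[of "b (f n)"] unfolding orthonormal_def by (metis of_real_eq_1_iff)
  ultimately show ?case using Suc by (simp add: norm_add_square_cinner)
qed simp

section \<open>Cesaro means and strong convergence of contractions\<close>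

definition cesaro_mean :: "('a::real_vector \<Rightarrow> 'a) \<Rightarrow> nat \<Rightarrow> 'a \<Rightarrow> 'a"
  where "cesaro_mean f n x = (1 / real n) *\<^sub>R (\<Sum>j<n. (f ^^ j) x)"

lemma bounded_linear_funpow:
  fixes f :: "'a::real_normed_vector \<Rightarrow> 'a"
  assumes "bounded_linear f"
  shows "bounded_linear (f ^^ n)"
proof (induction n)
  case 0
  have "f ^^ 0 = (\<lambda>x. x)" by auto
  then show ?case by (simp only: bounded_linear_ident)
next
  case (Suc n)
  have "f ^^ Suc n = (\<lambda>x. f ((f ^^ n) x))" by auto
  then show ?case using bounded_linear_compose[OF assms Suc] by (simp only:)
qed

lemma bounded_linear_cesaro_mean: "bounded_linear f \<Longrightarrow> bounded_linear (cesaro_mean f n)"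
  unfolding cesaro_mean_def
  by (intro bounded_linear_compose[OF bounded_linear_scaleR_right] bounded_linear_sum
      bounded_linear_funpow)

lemma norm_cesaro_mean_le:
  fixes f :: "'a::real_normed_vector \<Rightarrow> 'a"
  assumes "\<And>x. norm (f x) \<le> norm x"
  shows "norm (cesaro_mean f n x) \<le> norm x"
proof -
  have "norm ((f ^^ j) x) \<le> norm x" for j
    by (induction j) (use assms order_trans in auto)
  then have "norm (\<Sum>j<n. (f ^^ j) x) \<le> real n * norm x"
    using sum_norm_bound[of "{..<n}" "\<lambda>j. (f ^^ j) x" "norm x"] by simp
  \<comment> \<open>For \<open>n = 0\<close> the mean is \<open>0\<close>, because
    \<open>1 / 0 = 0\<close>.\<close>
  then show ?thesis by (cases "n = 0") (simp_all add: cesaro_mean_def field_simps)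
qed

text \<open>The vectors with limit \<open>0\<close> form a subspace containing \<open>X\<close>, and
  contractivity of every \<open>T n\<close> extends convergence to its closure. The filter
  \<open>F\<close> is arbitrary so that the lemma serves both sequences and the limit of a real
  parameter.\<close>

lemma equibounded_tendsto_zero:
  fixes T :: "'i \<Rightarrow> 'a::real_normed_vector \<Rightarrow> 'b::real_normed_vector"
  assumes T: "\<And>n. bounded_linear (T n)" "\<And>n x. norm (T n x) \<le> norm x"
    and X: "closure (span X) = UNIV" "\<And>x. x \<in> X \<Longrightarrow> ((\<lambda>n. T n x) \<longlongrightarrow> 0) F"
  shows "((\<lambda>n. T n x) \<longlongrightarrow> 0) F"
proof -
  let ?S = "{x. ((\<lambda>n. T n x) \<longlongrightarrow> 0) F}"
  have lin: "T n (x + y) = T n x + T n y" "T n (c *\<^sub>R x) = c *\<^sub>R T n x" "T n (x - y) = T n x - T n y"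
    for n x y c
    using bounded_linear.linear[OF T(1)] by (simp_all add: linear_add linear_scale linear_diff)
  have "subspace ?S"
  proof (rule subspaceI)
    show "0 \<in> ?S" using lin(2)[of _ 0 0] by simp
    show "x + y \<in> ?S" if "x \<in> ?S" "y \<in> ?S" for x y
      using tendsto_add[of "\<lambda>n. T n x" 0 F "\<lambda>n. T n y" 0] that by (simp add: lin)
    show "c *\<^sub>R x \<in> ?S" if "x \<in> ?S" for c x
      using tendsto_scaleR[OF tendsto_const, of "\<lambda>n. T n x" 0 F c] that by (simp add: lin)
  qed
  then have "span X \<subseteq> ?S"
    using X(2) by (intro span_minimal) auto
  moreover have "x \<in> closure (span X)" using X(1) by simp
  ultimately have approx: "\<exists>y\<in>?S. dist y x < e" if "e > 0" for e
    using that unfolding closure_approachable by blast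
  show ?thesis
  proof (rule tendstoI)
    fix e :: real assume "e > 0"
    then obtain y where y: "((\<lambda>n. T n y) \<longlongrightarrow> 0) F" "dist y x < e / 2"
      using approx[of "e / 2"] by auto
    have "\<forall>\<^sub>F n in F. norm (T n y) < e / 2"
      using tendsto_norm_zero[OF y(1)] \<open>e > 0\<close> by (intro order_tendstoD(2)) auto
    then show "\<forall>\<^sub>F n in F. dist (T n x) 0 < e"
    proof (rule eventually_mono)
      fix n assume *: "norm (T n y) < e / 2"
      have "norm (T n x) \<le> norm (T n y) + norm (T n (x - y))"
        using norm_triangle_ineq[of "T n y" "T n x - T n y"] by (simp add: lin)
      also have "norm (T n (x - y)) \<le> norm (x - y)" by (rule T(2))
      finally show "dist (T n x) 0 < e"
        using * y(2) by (simp add: dist_norm norm_minus_commute)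
    qed
  qed
qed

text \<open>\<open>V\<close> and \<open>W\<close> send an orthonormal basis to its odd and even
  members, so their ranges are orthogonal. Under \<open>V\<close> every basis vector has an
  orthonormal orbit, which makes its Cesaro means vanish in the limit.\<close>

lemma ex_orthogonal_isometries:
  assumes "separable_space (euclidean :: 'h::complex_hilbert topology)"
    and "\<nexists>B :: 'h set. finite B \<and> complex_vector.span B = UNIV"
  shows "\<exists>(V :: 'h \<Rightarrow> 'h) (W :: 'h \<Rightarrow> 'h). bounded_linear V \<and> complex_linear V \<and> bounded_linear W \<and> complex_linear W \<and>
    (\<forall>x y. cinner (V x) (V y) = cinner x y) \<and> (\<forall>x y. cinner (W x) (W y) = cinner x y) \<and>
    (\<forall>x y. cinner (V x) (W y) = 0) \<and> (\<forall>x. (\<lambda>n. cesaro_mean V n x) \<longlonglongrightarrow> 0)"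
proof -
  obtain b :: "nat \<Rightarrow> 'h" where b: "orthonormal b" "closure (complex_vector.span (range b)) = UNIV"
    using ex_orthonormal_sequence_dense_span[OF assms] by blast
  let ?X = "{c *\<^sub>C x |c x. x \<in> range b}"
  have X: "closure (span ?X) = UNIV" using b(2) by (simp add: span_scaleC_multiples)
  have "orthonormal (\<lambda>i. b (2 * i + 1))" "orthonormal (\<lambda>i. b (2 * i))"
    using b(1) by (simp_all add: orthonormal_def)
  note ortho = this
  obtain V where V: "bounded_linear V" "complex_linear V"
      "\<And>x y. cinner (V x) (V y) = cinner x y" "\<And>i. V (b i) = b (2 * i + 1)"
    using complex_linear_isometry_extension[OF b ortho(1)] by blast
  obtain W where W: "bounded_linear W" "complex_linear W"
      "\<And>x y. cinner (W x) (W y) = cinner x y" "\<And>i. W (b i) = b (2 * i)"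
    using complex_linear_isometry_extension[OF b ortho(2)] by blast
  have "cinner (V x) (W y) = 0" for x y
  proof (rule bounded_bilinear_eq_on_dense[OF _ _ X X, of "\<lambda>x y. cinner (V x) (W y)" "\<lambda>x y. 0"])
    show "bounded_bilinear (\<lambda>x y. cinner (V x) (W y))"
      by (rule bounded_bilinear.comp[OF bounded_bilinear_cinner V(1) W(1)])
    show "bounded_bilinear (\<lambda>(x :: 'h) (y :: 'h). 0 :: complex)"
      by unfold_locales (auto intro: exI[of _ 0])
    fix x y assume "x \<in> ?X" "y \<in> ?X"
    moreover have "2 * i + 1 \<noteq> 2 * j" for i j :: nat by presburger
    ultimately show "cinner (V x) (W y) = 0"
      using V(2,4) W(2,4) b(1)
      by (auto simp: complex_linear_def orthonormal_def cinner_scaleC_left cinner_scaleC_right)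
  qed
  moreover have "(\<lambda>n. cesaro_mean V n x) \<longlonglongrightarrow> 0" for x
  proof (rule equibounded_tendsto_zero[of "cesaro_mean V", OF _ _ X])
    show "bounded_linear (cesaro_mean V n)" for n by (rule bounded_linear_cesaro_mean[OF V(1)])
    have "norm (V x) = norm x" for x
      using V(3)[of x x] by (simp add: cinner_self flip: of_real_power)
    then show "norm (cesaro_mean V n x) \<le> norm x" for n x
      using norm_cesaro_mean_le[of V n x] by simp
    fix x assume "x \<in> ?X"
    then obtain c i where x: "x = c *\<^sub>C b i" by blast
    \<comment> \<open>The index of the \<open>j\<close>-th iterate. It strictly increases because
      \<open>2 * m + 1 > m\<close>; the even map would not do here, as \<open>W\<close> fixes
      \<open>b 0\<close>.\<close>
    define f where "f j = ((\<lambda>i. 2 * i + 1) ^^ j) i" for j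
    have "strict_mono f" unfolding strict_mono_Suc_iff by (simp add: f_def)
    have "(V ^^ j) x = c *\<^sub>C b (f j)" for j
      by (induction j) (use V(2,4) in \<open>auto simp: x f_def complex_linear_def\<close>)
    then have "(\<Sum>j<n. (V ^^ j) x) = c *\<^sub>C (\<Sum>j<n. b (f j))" for n
      by (simp add: complex_vector.scale_sum_right)
    moreover have "norm (\<Sum>j<n. b (f j)) = sqrt (real n)" for n
      using norm_sum_orthonormal[OF b(1) strict_mono_imp_inj_on[OF \<open>strict_mono f\<close>], of n]
      by (metis norm_ge_zero real_sqrt_unique)
    ultimately have "norm (cesaro_mean V n x) = cmod c * (sqrt (real n) / real n)" for n
      by (simp add: cesaro_mean_def norm_scaleC)
    moreover have "sqrt (real n) / real n = 1 / sqrt (real n)" for n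
      by (cases "n = 0") (simp_all add: field_simps)
    moreover have "(\<lambda>n. cmod c * (1 / sqrt (real n))) \<longlonglongrightarrow> cmod c * 0"
      by (intro tendsto_intros real_tendsto_divide_at_top[OF tendsto_const]
          filterlim_compose[OF sqrt_at_top filterlim_real_sequentially])
    ultimately have "(\<lambda>n. norm (cesaro_mean V n x)) \<longlonglongrightarrow> 0" by simp
    then show "(\<lambda>n. cesaro_mean V n x) \<longlonglongrightarrow> 0" by (rule tendsto_norm_zero_cancel)
  qed
  ultimately show ?thesis
    using V(1-3) W(1-3) by - (rule exI[of _ V], rule exI[of _ W], blast)
qed

section \<open>Maps of a C*-algebra preserving \<open>x\<^sup>* y\<close>\<close>

lemma adj_zero [simp]: "adj 0 = 0"
  using adj_add[of 0 0] by simp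

lemma adj_minus: "adj (- x) = - adj x"
  using adj_add[of x "- x"] by (simp add: add_eq_0_iff)

lemma adj_diff: "adj (x - y) = adj x - adj y"
  using adj_add[of x "- y"] by (simp add: adj_minus)

lemma adj_scaleR: "adj (r *\<^sub>R x) = r *\<^sub>R adj x"
  by (simp add: scaleR_scaleC adj_scaleC)

lemma norm_adj: "norm (adj x) = norm x"
proof -
  have le: "norm y \<le> norm (adj y)" for y :: 'a
  proof (cases "norm y = 0")
    case False
    have "norm y * norm y \<le> norm (adj y) * norm y"
      using norm_mult_ineq[of "adj y" y] by (simp add: cstar_identity power2_eq_square)
    then show ?thesis using False by simp
  qed simp
  show ?thesis using le[of x] le[of "adj x"] by (simp add: adj_adj)
qed

lemma bounded_linear_adj: "bounded_linear adj"
  by (rule bounded_linear_intro[of _ 1]) (simp_all add: adj_add adj_scaleR norm_adj)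

lemma bounded_bilinear_adj_mult: "bounded_bilinear (\<lambda>x y :: 'a::cstar_algebra. adj x * y)"
  by (rule bounded_bilinear.comp[OF bounded_bilinear_mult bounded_linear_adj bounded_linear_ident])

lemma norm_eq_if_adj_mult_eq:
  fixes x :: "'a::cstar_algebra" and y :: "'b::cstar_algebra"
  assumes "norm (adj x * x) = norm (adj y * y)"
  shows "norm x = norm y"
  using assms by (simp add: cstar_identity)

text \<open>The analogue of preserving an inner product, with \<open>adj x * y\<close> as an
  algebra-valued inner product. By the C*-identity such maps preserve the norm.\<close>

definition gram_preserving :: "('a::cstar_algebra \<Rightarrow> 'a) \<Rightarrow> bool"
  where "gram_preserving L \<longleftrightarrow> (\<forall>x y. adj (L x) * L y = adj x * y)"

lemma gram_preservingD: "gram_preserving L \<Longrightarrow> adj (L x) * L y = adj x * y"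
  by (simp add: gram_preserving_def)

lemma norm_gram_preserving: "gram_preserving L \<Longrightarrow> norm (L x) = norm x"
  by (rule norm_eq_if_adj_mult_eq) (simp add: gram_preservingD)

text \<open>Expanding the square of \<open>L x - L y\<close> leaves four Gram products, each
  preserved by \<open>L\<close>.\<close>

lemma dist_gram_preserving:
  assumes "gram_preserving L"
  shows "dist (L x) (L y) = dist x y"
  unfolding dist_norm
  by (rule norm_eq_if_adj_mult_eq) (use assms in \<open>simp add: adj_diff algebra_simps gram_preservingD\<close>)

lemma gram_preserving_funpow: "gram_preserving L \<Longrightarrow> gram_preserving (L ^^ n)"
  by (induction n) (simp_all add: gram_preserving_def)

section \<open>Left multiplication on compact operators\<close>

text \<open>An isometry \<open>W\<close> of an infinite-dimensional space is not compact, so it is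
  no element of \<open>compact_op\<close>. The left multiplication is therefore built from
  composition of operators.\<close>

lemma ex_left_multiplication:
  assumes "bounded_linear W" "complex_linear W"
  shows "\<exists>L. \<forall>(k :: 'h::complex_hilbert compact_op) x. op_of (L k) x = W (op_of k x)"
proof (rule exI[of _ "\<lambda>k. Compact_Op (Blinfun (\<lambda>x. W (op_of k x)))"], intro allI)
  fix k :: "'h compact_op" and x
  have "bounded_linear (\<lambda>x. W (op_of k x))"
    by (rule bounded_linear_compose[OF assms(1) blinfun.bounded_linear_right])
  then have eq: "blinfun_apply (Blinfun (\<lambda>x. W (op_of k x))) = (\<lambda>x. W (op_of k x))"
    by (rule bounded_linear_Blinfun_apply)
  have "compact_operator (\<lambda>x. W (op_of k x))"
    using op_of[of k] assms compact_operator_compose_left[of "blinfun_apply (op_of k)" W] by simp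
  then show "op_of (Compact_Op (Blinfun (\<lambda>x. W (op_of k x)))) x = W (op_of k x)"
    using eq by (simp add: Compact_Op_inverse)
qed

lemma adj_mult_eq_compact_op:
  fixes k l k' l' :: "'h::complex_hilbert compact_op"
  assumes "\<And>x y. cinner (op_of k x) (op_of l y) = cinner (op_of k' x) (op_of l' y)"
  shows "adj k * l = adj k' * l'"
  by (intro compact_op_eqI cinner_extensionality) (simp add: op_of_times cinner_adj' assms)

text \<open>Composition with a compact operator turns strong convergence into norm convergence:
  pointwise convergence is uniform on a finite net of the image of the unit ball, and contractivity
  covers the rest of the image.\<close>

lemma contractions_tendsto_zero_on_compact_op:
  fixes T :: "nat \<Rightarrow> 'h::complex_hilbert \<Rightarrow> 'h"
  assumes T: "\<And>n. bounded_linear (T n)" "\<And>n x. norm (T n x) \<le> norm x" "\<And>x. (\<lambda>n. T n x) \<longlonglongrightarrow> 0"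
    and S: "\<And>n x. op_of (S n) x = T n (op_of k x)"
  shows "S \<longlonglongrightarrow> 0"
proof (rule LIMSEQ_I)
  fix e :: real assume "e > 0"
  have "compact (closure (op_of k ` cball 0 1))"
    using op_of[of k] by (simp add: compact_operator_def)
  then obtain F where F: "finite F" "op_of k ` cball 0 1 \<subseteq> (\<Union>y\<in>F. ball y (e / 4))"
    using \<open>e > 0\<close> unfolding compact_closure_iff_nets by (meson zero_less_divide_iff zero_less_numeral)
  have "\<forall>\<^sub>F n in sequentially. \<forall>y\<in>F. norm (T n y) < e / 4"
  proof (rule eventually_ball_finite[OF F(1)], intro ballI)
    fix y
    show "\<forall>\<^sub>F n in sequentially. norm (T n y) < e / 4"
      using tendsto_norm_zero[OF T(3)[of y]] \<open>e > 0\<close> by (intro order_tendstoD) auto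
  qed
  then obtain N where N: "\<And>n y. n \<ge> N \<Longrightarrow> y \<in> F \<Longrightarrow> norm (T n y) < e / 4"
    unfolding eventually_sequentially by blast
  have "norm (S n) < e" if "n \<ge> N" for n
  proof -
    have unit: "norm (op_of (S n) x) \<le> e / 2" if "norm x \<le> 1" for x
    proof -
      have "op_of k x \<in> op_of k ` cball 0 1" using that by simp
      then obtain y where y: "y \<in> F" "dist y (op_of k x) < e / 4" using F(2) by auto
      have "op_of (S n) x = T n y - T n (y - op_of k x)"
        using bounded_linear.linear[OF T(1)] by (simp add: S linear_diff)
      also have "norm \<dots> \<le> norm (T n y) + norm (y - op_of k x)"
        using norm_triangle_ineq4 T(2) by (meson add_left_mono order_trans)
      finally show ?thesis using N[OF \<open>n \<ge> N\<close> y(1)] y(2) by (simp add: dist_norm)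
    qed
    have "norm (op_of (S n)) \<le> e / 2"
    proof (rule norm_blinfun_bound)
      show "0 \<le> e / 2" using \<open>e > 0\<close> by simp
      show "norm (op_of (S n) x) \<le> e / 2 * norm x" for x
      proof (cases "x = 0")
        case False
        then have "norm (op_of (S n) (inverse (norm x) *\<^sub>R x)) \<le> e / 2"
          by (intro unit) simp
        then show ?thesis using False by (simp add: blinfun.scaleR_right field_simps)
      qed simp
    qed
    then show ?thesis using \<open>e > 0\<close> by (simp add: norm_compact_op.rep_eq)
  qed
  then show "\<exists>N. \<forall>n\<ge>N. norm (S n - 0) < e" by auto
qed

lemma op_of_cesaro_mean:
  assumes L: "\<And>k x. op_of (L k) x = V (op_of k x)"
  shows "op_of (cesaro_mean L n k) x = cesaro_mean V n (op_of k x)"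
proof -
  have "op_of ((L ^^ j) k) x = (V ^^ j) (op_of k x)" for j
    by (induction j) (simp_all add: L)
  then have "op_of (\<Sum>j<n. (L ^^ j) k) x = (\<Sum>j<n. (V ^^ j) (op_of k x))"
    by (induction n)
      (simp_all add: zero_compact_op.rep_eq plus_compact_op.rep_eq blinfun.add_left)
  then show ?thesis
    by (simp add: cesaro_mean_def scaleR_compact_op.rep_eq blinfun.scaleR_left)
qed

text \<open>Telescoping writes \<open>x - (L ^^ j) x\<close> as a sum of elements
  \<open>y - L y\<close>; averaging over \<open>j\<close> keeps it in this subspace. For
  \<open>n > 0\<close> the weights sum to \<open>1\<close>.\<close>

lemma diff_cesaro_mean_in_range:
  assumes L: "linear L" and n: "n > 0"
  shows "x - cesaro_mean L n x \<in> range (\<lambda>x. x - L x)"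
proof -
  have sub: "subspace (range (\<lambda>x. x - L x))"
    by (intro linear_subspace_image subspace_UNIV linear_compose_sub linear_ident L)
  have pow: "x - (L ^^ j) x \<in> range (\<lambda>x. x - L x)" for j
  proof (induction j)
    case 0
    show ?case using subspace_0[OF sub] by simp
  next
    case (Suc j)
    have "x - (L ^^ Suc j) x = (x - (L ^^ j) x) + ((L ^^ j) x - L ((L ^^ j) x))" by simp
    also have "\<dots> \<in> range (\<lambda>x. x - L x)" by (rule subspace_add[OF sub Suc]) (rule rangeI)
    finally show ?case .
  qed
  have "x - cesaro_mean L n x = (1 / real n) *\<^sub>R (\<Sum>j<n. x - (L ^^ j) x)"
    using n by (simp add: cesaro_mean_def sum_subtractf scaleR_diff_right sum_constant_scaleR)
  also have "\<dots> \<in> range (\<lambda>x. x - L x)"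
    by (intro subspace_scale[OF sub] subspace_sum[OF sub] pow)
  finally show ?thesis .
qed

text \<open>\<open>L\<close> and \<open>M\<close> are left multiplication by two isometries with
  orthogonal ranges. Density holds since \<open>k\<close> is the limit of
  \<open>k - cesaro_mean L n k\<close>, elements of the range for \<open>n > 0\<close>.\<close>

lemma ex_gram_preserving_compact_op:
  assumes "separable_space (euclidean :: 'h::complex_hilbert topology)"
    and "\<nexists>B :: 'h set. finite B \<and> complex_vector.span B = UNIV"
  shows "\<exists>L M :: 'h compact_op \<Rightarrow> 'h compact_op. gram_preserving L \<and> gram_preserving M \<and>
    (\<forall>k l. adj (L k) * M l = 0) \<and> closure (range (\<lambda>k. k - L k)) = UNIV"
proof -
  obtain V W :: "'h \<Rightarrow> 'h" where V: "bounded_linear V" "complex_linear V"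
      "\<And>x y. cinner (V x) (V y) = cinner x y" "\<And>x. (\<lambda>n. cesaro_mean V n x) \<longlonglongrightarrow> 0"
    and W: "bounded_linear W" "complex_linear W" "\<And>x y. cinner (W x) (W y) = cinner x y"
    and VW: "\<And>x y. cinner (V x) (W y) = 0"
    using ex_orthogonal_isometries[OF assms] by blast
  obtain L :: "'h compact_op \<Rightarrow> 'h compact_op" where L: "\<And>k x. op_of (L k) x = V (op_of k x)"
    using ex_left_multiplication[OF V(1,2)] by blast
  obtain M :: "'h compact_op \<Rightarrow> 'h compact_op" where M: "\<And>k x. op_of (M k) x = W (op_of k x)"
    using ex_left_multiplication[OF W(1,2)] by blast
  have "gram_preserving L" "gram_preserving M"
    unfolding gram_preserving_def
    by (intro allI adj_mult_eq_compact_op; simp add: L M V(3) W(3))+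
  moreover have "adj (L k) * M l = 0" for k l
    using adj_mult_eq_compact_op[of "L k" "M l" 0 0] by (simp add: L M VW zero_compact_op.rep_eq)
  moreover have "k \<in> closure (range (\<lambda>k. k - L k))" for k
  proof -
    have linV: "linear V" by (rule bounded_linear.linear[OF V(1)])
    have "linear L"
      by (rule linearI; rule compact_op_eqI)
        (simp_all add: L plus_compact_op.rep_eq scaleR_compact_op.rep_eq blinfun.add_left
          blinfun.scaleR_left linear_add[OF linV] linear_scale[OF linV])
    have "norm (V x) = norm x" for x
      using V(3)[of x x] by (simp add: cinner_self flip: of_real_power)
    then have "(\<lambda>n. cesaro_mean L n k) \<longlonglongrightarrow> 0"
      by (intro contractions_tendsto_zero_on_compact_op[of "cesaro_mean V" _ k]
          bounded_linear_cesaro_mean norm_cesaro_mean_le V(1,4) op_of_cesaro_mean L) simp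
    then have "(\<lambda>n. k - cesaro_mean L n k) \<longlonglongrightarrow> k - 0"
      by (intro tendsto_intros)
    \<comment> \<open>The shift drops the term \<open>n = 0\<close>, which is \<open>k\<close>
      itself and need not lie in the range.\<close>
    from LIMSEQ_Suc[OF this] have "(\<lambda>n. k - cesaro_mean L (Suc n) k) \<longlonglongrightarrow> k"
      by simp
    moreover have "k - cesaro_mean L (Suc n) k \<in> range (\<lambda>k. k - L k)" for n
      by (rule diff_cesaro_mean_in_range[OF \<open>linear L\<close>]) simp
    ultimately show ?thesis
      unfolding closure_sequential
      by (intro exI[of _ "\<lambda>n. k - cesaro_mean L (Suc n) k"] conjI allI)
  qed
  ultimately show ?thesis by - (rule exI[of _ L], rule exI[of _ M], blast)
qed

section \<open>Tensor products\<close>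

locale cstar_tensor_product =
  fixes tensor :: "'k::cstar_algebra \<Rightarrow> 'a::cstar_algebra \<Rightarrow> 'b::cstar_algebra"
  assumes tensor: "is_cstar_tensor_product tensor"
begin

lemma tensor_add_left: "tensor (x + y) a = tensor x a + tensor y a"
  and tensor_scaleC_left: "tensor (c *\<^sub>C x) a = c *\<^sub>C tensor x a"
  and tensor_mult: "tensor x a * tensor y b = tensor (x * y) (a * b)"
  and adj_tensor: "adj (tensor x a) = tensor (adj x) (adj a)"
  using tensor unfolding is_cstar_tensor_product_def by (elim conjE; simp only:)+

lemma linear_tensor_left: "linear (\<lambda>x. tensor x a)"
  by (rule linearI) (simp_all add: tensor_add_left tensor_scaleC_left scaleR_scaleC)

lemma adj_tensor_mult: "adj (tensor x a) * tensor y b = tensor (adj x * y) (adj a * b)"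
  by (simp add: adj_tensor tensor_mult)

text \<open>A complex multiple of an elementary tensor is again one, so their real and complex spans
  coincide.\<close>

lemma closure_span_tensors: "closure (span {tensor x a |x a. True}) = UNIV"
proof -
  let ?T = "{tensor x a |x a. True}"
  have "{c *\<^sub>C t |c t. t \<in> ?T} = ?T"
  proof
    show "{c *\<^sub>C t |c t. t \<in> ?T} \<subseteq> ?T"
    proof clarify
      fix c x a
      show "\<exists>y b. c *\<^sub>C tensor x a = tensor y b \<and> True"
        by (intro exI conjI, rule tensor_scaleC_left[symmetric], rule TrueI)
    qed
    show "?T \<subseteq> {c *\<^sub>C t |c t. t \<in> ?T}"
    proof
      fix t assume "t \<in> ?T"
      then have "t = 1 *\<^sub>C t \<and> t \<in> ?T" by (simp add: scaleC_one)
      then show "t \<in> {c *\<^sub>C t |c t. t \<in> ?T}" by blast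
    qed
  qed
  then have "span ?T = complex_vector.span ?T"
    using span_scaleC_multiples[of ?T] by (simp only:)
  moreover have "closure (complex_vector.span ?T) = UNIV"
    using tensor unfolding is_cstar_tensor_product_def by (elim conjE)
  ultimately show ?thesis by (simp only:)
qed

text \<open>By the C*-identity the squared norm of \<open>tensor x a\<close> is that of
  \<open>tensor (adj x * x) (adj a * a)\<close>, which sees \<open>x\<close> only through
  \<open>adj x * x\<close>.\<close>

lemma norm_tensor_cong:
  assumes "adj x * x = adj y * y"
  shows "norm (tensor x a) = norm (tensor y a)"
  by (rule norm_eq_if_adj_mult_eq) (simp add: adj_tensor_mult assms)

text \<open>Since \<open>x\<close> and \<open>y\<close> are orthogonal, the reflected element \<open>y - x\<close> has the same square as
  \<open>x + y\<close>, and \<open>x\<close> is half the difference of the two.\<close>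

lemma norm_tensor_le_add:
  assumes xy: "adj x * y = 0"
  shows "norm (tensor x a) \<le> norm (tensor (x + y) a)"
proof -
  interpret linear "\<lambda>x. tensor x a" by (rule linear_tensor_left)
  have "adj (adj x * y) = 0" using xy by simp
  then have yx: "adj y * x = 0" by (simp add: adj_mult adj_adj)
  have "2 *\<^sub>R tensor x a = tensor (x + y) a - tensor (y - x) a"
    by (simp add: add diff scaleR_2)
  then have "2 * norm (tensor x a) \<le> norm (tensor (x + y) a) + norm (tensor (y - x) a)"
    using norm_triangle_ineq4[of "tensor (x + y) a" "tensor (y - x) a"]
    by (metis abs_numeral norm_scaleR)
  also have "norm (tensor (y - x) a) = norm (tensor (x + y) a)"
    by (rule norm_tensor_cong) (simp add: adj_add adj_diff algebra_simps xy yx)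
  finally show ?thesis by simp
qed

text \<open>A gliding hump: if \<open>x \<mapsto> x \<otimes> a\<close> were unbounded on elements \<open>x n\<close> with
  \<open>\<parallel>x n\<parallel> = 2 ^ (- n)\<close>, it would have no finite value at the orthogonal sum of the \<open>(L ^^ n) (M (x n))\<close>.\<close>

lemma bounded_linear_tensor_left:
  fixes L M :: "'k \<Rightarrow> 'k"
  assumes L: "gram_preserving L" and M: "gram_preserving M" and LM: "\<And>x y. adj (L x) * M y = 0"
  shows "bounded_linear (\<lambda>x. tensor x a)"
proof -
  interpret linear "\<lambda>x. tensor x a" by (rule linear_tensor_left)
  have "\<exists>K. \<forall>x. norm (tensor x a) \<le> norm x * K"
  proof (rule ccontr)
    assume unbounded: "\<nexists>K. \<forall>x. norm (tensor x a) \<le> norm x * K"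
    have "\<exists>x. norm (tensor x a) > norm x * c" for c
      using spec[OF unbounded[unfolded not_ex], of c] unfolding not_all not_le .
    then have "\<exists>x. norm (tensor x a) > norm x * (real n * 2 ^ n)" for n .
    then obtain z where z: "\<And>n. norm (tensor (z n) a) > norm (z n) * (real n * 2 ^ n)"
      by metis
    have nz: "z n \<noteq> 0" for n using z[of n] zero by auto
    \<comment> \<open>After this scaling the norms \<open>2 ^ (- n)\<close> are summable, while the
      factor \<open>real n * 2 ^ n\<close> in the choice of \<open>z\<close> keeps the tensor norms
      above \<open>n\<close>.\<close>
    define x where "x n = (1 / (2 ^ n * norm (z n))) *\<^sub>R z n" for n
    have norm_x: "norm (x n) = (1 / 2) ^ n" for n
      using nz[of n] by (simp add: x_def power_one_over)
    have tensor_x: "norm (tensor (x n) a) > real n" for n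
      using z[of n] nz[of n] by (simp add: x_def scale field_simps)
    define J where "J n = (L ^^ n) (M (x n))" for n
    have orth_less: "adj (J m) * J n = 0" if less: "m < n" for m n
    proof -
      obtain d where d: "n = m + Suc d" using less_imp_Suc_add[OF less] by auto
      have "adj (L y) * M (x m) = 0" for y by (rule LM)
      then have "adj (M (x m)) * L y = 0" for y
        by (metis adj_adj adj_mult adj_zero)
      \<comment> \<open>Cancelling the common \<open>L ^^ m\<close> leaves an element of the range
        of \<open>M\<close> against one of the range of \<open>L\<close>.\<close>
      moreover have "J n = (L ^^ m) (L ((L ^^ d) (M (x n))))"
        unfolding J_def d by (simp only: funpow_add funpow.simps o_apply)
      ultimately show ?thesis
        by (simp only: J_def[of m] gram_preservingD[OF gram_preserving_funpow[OF L]])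
    qed
    have orth: "adj (J m) * J n = 0" if "m \<noteq> n" for m n
    proof (cases "m < n")
      case False
      then have "adj (J n) * J m = 0" using that by (intro orth_less) simp
      then show ?thesis by (metis adj_adj adj_mult adj_zero)
    qed (rule orth_less)
    have gram_J: "adj (J n) * J n = adj (x n) * x n" for n
      using gram_preservingD[OF gram_preserving_funpow[OF L]] gram_preservingD[OF M] by (simp add: J_def)
    then have "norm (J n) = (1 / 2) ^ n" for n
      using norm_x[of n] by (metis norm_eq_if_adj_mult_eq)
    then have summable: "summable J"
      by (intro summable_norm_cancel[of J]) (simp add: summable_geometric)
    define y where "y = (\<Sum>n. J n)"
    have "adj (J n) * (y - J n) = 0" for n
    proof -
      have "adj (J n) * y = (\<Sum>m. adj (J n) * J m)"
        unfolding y_def by (rule bounded_linear.suminf[OF bounded_linear_mult_right summable])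
      also have "\<dots> = (\<Sum>m. if m = n then adj (J n) * J n else 0)"
        by (rule suminf_cong) (use orth in auto)
      also have "\<dots> = adj (J n) * J n"
        using sums_single[of n "\<lambda>_. adj (J n) * J n"] by (simp add: sums_iff)
      finally show ?thesis by (simp add: algebra_simps)
    qed
    \<comment> \<open>\<open>y\<close> splits orthogonally into \<open>J n\<close> and the remaining
      terms of the series.\<close>
    then have "norm (tensor (J n) a) \<le> norm (tensor y a)" for n
      using norm_tensor_le_add[of "J n" "y - J n"] by simp
    then have "real n < norm (tensor y a)" for n
      using norm_tensor_cong[OF gram_J[of n]] tensor_x[of n] by (metis less_le_trans)
    then show False using reals_Archimedean2[of "norm (tensor y a)"] by (metis less_asym)
  qed
  then obtain K where "\<And>x. norm (tensor x a) \<le> norm x * K" by blast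
  then show ?thesis by (intro bounded_linear_intro[of _ K]) (simp_all add: add scale)
qed

text \<open>The product \<open>adj (tensor x a) * tensor y b\<close> depends on \<open>x\<close> and
  \<open>y\<close> only through \<open>adj x * y\<close>, which \<open>L\<close> preserves. Hence
  the span of the pairs is an isometric graph, and it extends by density.\<close>

lemma ex_tensor_extension:
  fixes L :: "'k \<Rightarrow> 'k"
  assumes L: "gram_preserving L"
  shows "\<exists>L'. bounded_linear L' \<and> (\<forall>x a. L' (tensor x a) = tensor (L x) a)"
proof -
  define E where "E = {(tensor x a, tensor (L x) a) |x a. True}"
  have E: "(tensor x a, tensor (L x) a) \<in> E" for x a unfolding E_def by blast
  have "fst ` E = {tensor x a |x a. True}"
  proof
    show "fst ` E \<subseteq> {tensor x a |x a. True}"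
      unfolding E_def by (rule image_subsetI) (clarsimp, blast)
    show "{tensor x a |x a. True} \<subseteq> fst ` E"
      using image_eqI[OF _ E, of _ fst] by auto
  qed
  then have dense: "closure (fst ` span E) = UNIV"
    using closure_span_tensors by (simp only: linear_span_image[OF linear_fst, symmetric])
  have norm: "norm y = norm x" if "(x, y) \<in> span E" for x y
  proof -
    have "adj (snd p) * snd q = adj (fst p) * fst q" if "p \<in> span E" "q \<in> span E" for p q
    proof (rule bilinear_eq[of "\<lambda>p q. adj (snd p) * snd q" "\<lambda>p q. adj (fst p) * fst q"
          "span E" E "span E" E])
      show "bilinear (\<lambda>(p :: 'b \<times> 'b) (q :: 'b \<times> 'b). adj (snd p) * snd q)"
        using bounded_bilinear.comp[OF bounded_bilinear_adj_mult bounded_linear_snd bounded_linear_snd]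
        by (rule bilinear_if_bounded_bilinear)
      show "bilinear (\<lambda>(p :: 'b \<times> 'b) (q :: 'b \<times> 'b). adj (fst p) * fst q)"
        using bounded_bilinear.comp[OF bounded_bilinear_adj_mult bounded_linear_fst bounded_linear_fst]
        by (rule bilinear_if_bounded_bilinear)
      show "adj (snd p) * snd q = adj (fst p) * fst q" if "p \<in> E" "q \<in> E" for p q
        using that unfolding E_def by (auto simp: adj_tensor_mult gram_preservingD[OF L])
    qed (use that in auto)
    from this[OF that that] show ?thesis
      by - (rule norm_eq_if_adj_mult_eq[OF arg_cong[where f = norm]], simp)
  qed
  obtain L' where "bounded_linear L'" "\<And>x y. (x, y) \<in> span E \<Longrightarrow> L' x = y"
    using isometry_extension[OF subspace_span norm dense] by blast
  then show ?thesis using span_base[OF E] by blast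
qed

text \<open>The Gram identities are equalities of bounded bilinear maps, so elementary tensors
  suffice. Density of the range is carried over by approximating the first tensor factor.\<close>

lemma ex_gram_preserving_lift:
  fixes L M :: "'k \<Rightarrow> 'k"
  assumes L: "gram_preserving L" and M: "gram_preserving M" and LM: "\<And>x y. adj (L x) * M y = 0"
    and dense: "closure (range (\<lambda>x. x - L x)) = UNIV"
  shows "\<exists>L' M' :: 'b \<Rightarrow> 'b. bounded_linear L' \<and> gram_preserving L' \<and> gram_preserving M' \<and>
    (\<forall>x y. adj (L' x) * M' y = 0) \<and> closure (range (\<lambda>x. x - L' x)) = UNIV"
proof -
  obtain L' where L': "bounded_linear L'" "\<And>x a. L' (tensor x a) = tensor (L x) a"
    using ex_tensor_extension[OF L] by (elim exE conjE) (rule that, auto)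
  obtain M' where M': "bounded_linear M'" "\<And>x a. M' (tensor x a) = tensor (M x) a"
    using ex_tensor_extension[OF M] by (elim exE conjE) (rule that, auto)
  note dense_eq = bounded_bilinear_eq_on_dense[OF _ _ closure_span_tensors closure_span_tensors]
  note comp = bounded_bilinear.comp[OF bounded_bilinear_adj_mult]
  have "gram_preserving L'"
    unfolding gram_preserving_def
    by (intro allI, rule dense_eq[OF comp[OF L'(1) L'(1)] bounded_bilinear_adj_mult])
      (auto simp: L'(2) adj_tensor_mult gram_preservingD[OF L])
  moreover have "gram_preserving M'"
    unfolding gram_preserving_def
    by (intro allI, rule dense_eq[OF comp[OF M'(1) M'(1)] bounded_bilinear_adj_mult])
      (auto simp: M'(2) adj_tensor_mult gram_preservingD[OF M])
  moreover have "adj (L' x) * M' y = 0" for x y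
  proof (rule dense_eq[OF comp[OF L'(1) M'(1)], of "\<lambda>x y. 0"])
    show "bounded_bilinear (\<lambda>(x :: 'b) (y :: 'b). 0 :: 'b)"
      by unfold_locales (auto intro: exI[of _ 0])
    have "tensor 0 a = 0" for a
      using linear_0[OF linear_tensor_left[of a]] .
    then show "adj (L' x) * M' y = 0"
      if "x \<in> {tensor x a |x a. True}" "y \<in> {tensor x a |x a. True}" for x y
      using that by (auto simp: L'(2) M'(2) adj_tensor_mult LM)
  qed
  moreover have "closure (range (\<lambda>x. x - L' x)) = UNIV"
  proof (rule closed_subspace_eq_UNIV[OF closure_span_tensors])
    show "subspace (closure (range (\<lambda>x. x - L' x)))"
      by (intro subspace_closure linear_subspace_image subspace_UNIV linear_compose_sub linear_ident
          bounded_linear.linear L'(1))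
    show "{tensor x a |x a. True} \<subseteq> closure (range (\<lambda>x. x - L' x))"
    proof clarify
      fix x a
      \<comment> \<open>Continuity in the first factor is what turns an approximation of
        \<open>x\<close> by elements \<open>z - L z\<close> into one of \<open>tensor x a\<close> by
        \<open>tensor z a - L' (tensor z a)\<close>.\<close>
      interpret bounded_linear "\<lambda>x. tensor x a"
        using L M LM by (rule bounded_linear_tensor_left)
      have "x \<in> closure (range (\<lambda>x. x - L x))" using dense by simp
      then obtain f where f: "\<And>n. f n \<in> range (\<lambda>x. x - L x)" "f \<longlonglongrightarrow> x"
        unfolding closure_sequential by blast
      have "tensor (f n) a \<in> range (\<lambda>x. x - L' x)" for n
      proof -
        obtain z where "f n = z - L z" using f(1)[of n] by (rule rangeE)
        then have "tensor (f n) a = tensor z a - L' (tensor z a)" by (simp add: L'(2) diff)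
        then show ?thesis by (rule range_eqI)
      qed
      then show "tensor x a \<in> closure (range (\<lambda>x. x - L' x))"
        unfolding closure_sequential using tendsto[OF f(2)]
        by (intro exI[of _ "\<lambda>n. tensor (f n) a"] conjI allI)
    qed
  qed simp
  ultimately show ?thesis using L'(1) by - (rule exI[of _ L'], rule exI[of _ M'], blast)
qed

end

section \<open>The contraction\<close>

text \<open>Moving \<open>x\<close> costs at most its displacement, uniformly in \<open>t\<close>;
  moving \<open>t\<close> at the fixed limit point costs little by \<open>cont\<close>. This gives
  joint continuity of a path that is only strongly continuous.\<close>

lemma continuous_on_Times_if_nonexpansive:
  fixes f :: "'t::metric_space \<Rightarrow> 'a::metric_space \<Rightarrow> 'b::metric_space"
  assumes nonexp: "\<And>t x y. t \<in> A \<Longrightarrow> dist (f t x) (f t y) \<le> dist x y"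
    and cont: "\<And>x. continuous_on A (\<lambda>t. f t x)"
  shows "continuous_on (A \<times> S) (\<lambda>(t, x). f t x)"
  unfolding continuous_on_iff
proof (intro ballI allI impI)
  fix p and e :: real assume p: "p \<in> A \<times> S" and "e > 0"
  then obtain d where d: "d > 0"
    "\<And>t. t \<in> A \<Longrightarrow> dist t (fst p) < d \<Longrightarrow> dist (f t (snd p)) (f (fst p) (snd p)) < e / 2"
    using cont[of "snd p", unfolded continuous_on_iff, rule_format, of "fst p" "e / 2"] by auto
  show "\<exists>d>0. \<forall>q\<in>A \<times> S. dist q p < d \<longrightarrow>
      dist (case q of (t, x) \<Rightarrow> f t x) (case p of (t, x) \<Rightarrow> f t x) < e"
  proof (intro exI[of _ "min d (e / 2)"] conjI ballI impI)
    show "min d (e / 2) > 0" using d(1) \<open>e > 0\<close> by simp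
    fix q assume q: "q \<in> A \<times> S" "dist q p < min d (e / 2)"
    have t: "fst q \<in> A" "dist (fst q) (fst p) < d" and x: "dist (snd q) (snd p) < e / 2"
      using q dist_fst_le[of q p] dist_snd_le[of q p] by auto
    have "dist (f (fst q) (snd q)) (f (fst p) (snd p))
        \<le> dist (f (fst q) (snd q)) (f (fst q) (snd p)) + dist (f (fst q) (snd p)) (f (fst p) (snd p))"
      by (rule dist_triangle)
    also have "\<dots> < e / 2 + e / 2"
      using nonexp[OF t(1), of "snd q" "snd p"] x d(2)[OF t] by linarith
    finally show "dist (case q of (t, x) \<Rightarrow> f t x) (case p of (t, x) \<Rightarrow> f t x) < e"
      by (simp add: case_prod_beta)
  qed
qed

lemma homotopic_with_canonI:
  fixes h :: "real \<Rightarrow> 'a::topological_space \<Rightarrow> 'b::topological_space"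
  assumes "continuous_on ({0..1} \<times> S) (\<lambda>(t, x). h t x)"
    and "\<And>t x. t \<in> {0..1} \<Longrightarrow> x \<in> S \<Longrightarrow> h t x \<in> T"
    and "\<And>x. x \<in> S \<Longrightarrow> h 0 x = f x" "\<And>x. x \<in> S \<Longrightarrow> h 1 x = g x"
  shows "homotopic_with_canon (\<lambda>_. True) S T f g"
proof -
  have cont: "continuous_map (prod_topology (top_of_set {0..1 :: real}) (top_of_set S))
      (top_of_set T) (\<lambda>(t, x). h t x)"
    using assms(1,2) by auto
  have "\<exists>k. continuous_map (prod_topology (top_of_set {0..1 :: real}) (top_of_set S)) (top_of_set T) k \<and>
      (\<forall>x\<in>topspace (top_of_set S). k (0, x) = f x) \<and> (\<forall>x\<in>topspace (top_of_set S). k (1, x) = g x) \<and>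
      (\<forall>t\<in>{0..1 :: real}. True)"
    by (rule exI[of _ "\<lambda>(t, x). h t x"]) (intro conjI cont; simp add: assms(3,4))
  then show ?thesis
    by (subst homotopic_with) auto
qed

text \<open>\<open>cayley a = (a - L) (1 - a L)\<^sup>-\<^sup>1\<close> runs through isometries from \<open>- L\<close> at \<open>a = 0\<close> to the identity
  at \<open>a = 1\<close>, where it is only strongly continuous.\<close>

locale mean_ergodic_isometry =
  fixes L :: "'b::cstar_algebra \<Rightarrow> 'b"
  assumes bounded_linear: "bounded_linear L"
    and gram: "gram_preserving L"
    and dense_range: "closure (range (\<lambda>x. x - L x)) = UNIV"
begin

sublocale L: bounded_linear L by (rule bounded_linear)

lemma norm_L [simp]: "norm (L x) = norm x"
  by (rule norm_gram_preserving[OF gram])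

text \<open>For \<open>0 \<le> a < 1\<close> this is the inverse of \<open>1 - a L\<close> applied
  to \<open>x\<close>, encoded as the fixed point that Banach's theorem supplies.\<close>

definition resolvent :: "real \<Rightarrow> 'b \<Rightarrow> 'b"
  where "resolvent a x = (THE z. z = x + a *\<^sub>R L z)"

definition cayley :: "real \<Rightarrow> 'b \<Rightarrow> 'b"
  where "cayley a x = (if a = 1 then x else a *\<^sub>R resolvent a x - L (resolvent a x))"

lemma ex1_resolvent:
  assumes "a \<in> {0..<1}"
  shows "\<exists>!z. z = x + a *\<^sub>R L z"
proof -
  have "\<exists>!z. x + a *\<^sub>R L z = z"
  proof (rule banach_fix_type[of a])
    show "\<forall>y z. dist (x + a *\<^sub>R L y) (x + a *\<^sub>R L z) \<le> a * dist y z"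
      using assms by (simp add: dist_norm flip: scaleR_diff_right L.diff)
  qed (use assms in auto)
  then show ?thesis by (simp only: eq_commute)
qed

lemma resolvent: "a \<in> {0..<1} \<Longrightarrow> resolvent a x = x + a *\<^sub>R L (resolvent a x)"
  unfolding resolvent_def by (rule theI'[OF ex1_resolvent])

lemma resolvent_eqI: "a \<in> {0..<1} \<Longrightarrow> z = x + a *\<^sub>R L z \<Longrightarrow> resolvent a x = z"
  using ex1_resolvent resolvent by blast

text \<open>Take norms in the fixed-point equation. In this form it says that \<open>1 - a\<close>
  times the resolvent is a contraction.\<close>

lemma norm_resolvent_le:
  assumes a: "a \<in> {0..<1}"
  shows "(1 - a) * norm (resolvent a x) \<le> norm x"
proof -
  have "norm (resolvent a x) \<le> norm x + a * norm (resolvent a x)"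
    using norm_triangle_ineq[of x "a *\<^sub>R L (resolvent a x)"] a
    by (simp flip: resolvent[OF a])
  then show ?thesis by (simp add: algebra_simps)
qed

lemma bounded_linear_resolvent:
  assumes a: "a \<in> {0..<1}"
  shows "bounded_linear (resolvent a)"
proof (rule bounded_linear_intro)
  show "resolvent a (x + y) = resolvent a x + resolvent a y" for x y
  proof (rule resolvent_eqI[OF a])
    have "x + y + a *\<^sub>R L (resolvent a x + resolvent a y)
        = (x + a *\<^sub>R L (resolvent a x)) + (y + a *\<^sub>R L (resolvent a y))"
      by (simp add: L.add scaleR_add_right add_ac)
    also have "\<dots> = resolvent a x + resolvent a y"
      by (simp only: resolvent[OF a, symmetric])
    finally show "resolvent a x + resolvent a y = x + y + a *\<^sub>R L (resolvent a x + resolvent a y)"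
      by (rule sym)
  qed
  show "resolvent a (c *\<^sub>R x) = c *\<^sub>R resolvent a x" for c x
  proof (rule resolvent_eqI[OF a])
    have "c *\<^sub>R x + a *\<^sub>R L (c *\<^sub>R resolvent a x) = c *\<^sub>R (x + a *\<^sub>R L (resolvent a x))"
      by (simp add: L.scaleR scaleR_add_right mult.commute)
    also have "\<dots> = c *\<^sub>R resolvent a x"
      by (simp only: resolvent[OF a, symmetric])
    finally show "c *\<^sub>R resolvent a x = c *\<^sub>R x + a *\<^sub>R L (c *\<^sub>R resolvent a x)"
      by (rule sym)
  qed
  show "norm (resolvent a x) \<le> norm x * (1 / (1 - a))" for x
    using norm_resolvent_le[OF a, of x] a by (simp add: field_simps)
qed

lemma tendsto_resolvent:
  assumes a: "a \<in> {0..<1}"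
  shows "((\<lambda>t. resolvent t x) \<longlongrightarrow> resolvent a x) (at a within {0..1})"
proof -
  let ?F = "at a within {0..1}"
  have ident: "((\<lambda>t. t) \<longlongrightarrow> a) ?F" by (rule tendsto_ident_at)
  have ev: "\<forall>\<^sub>F t in ?F. t \<in> {0..<1}"
  proof -
    have "\<forall>\<^sub>F t in ?F. t < 1" using a by (intro order_tendstoD(2)[OF ident]) simp
    moreover have "\<forall>\<^sub>F t in ?F. t \<in> {0..1}" by (simp add: eventually_at_filter)
    ultimately show ?thesis by eventually_elim auto
  qed
  have bound: "norm (resolvent t x - resolvent a x) \<le> \<bar>t - a\<bar> * norm (resolvent a x) / (1 - t)"
    if t: "t \<in> {0..<1}" for t
  proof -
    define z where "z = resolvent t x - resolvent a x"
    \<comment> \<open>Subtracting the two fixed-point equations isolates the factor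
      \<open>t - a\<close>; absorbing the term \<open>t *\<^sub>R L z\<close> then gives the
      bound.\<close>
    have "z = t *\<^sub>R L z + (t - a) *\<^sub>R L (resolvent a x)"
    proof -
      define u v where "u = resolvent t x" and "v = resolvent a x"
      have "u = x + t *\<^sub>R L u" unfolding u_def by (rule resolvent[OF t])
      moreover have "v = x + a *\<^sub>R L v" unfolding v_def by (rule resolvent[OF a])
      ultimately have "u - t *\<^sub>R L u = v - a *\<^sub>R L v"
        by (metis add_diff_cancel_right')
      then show ?thesis
        unfolding z_def u_def[symmetric] v_def[symmetric] by (simp add: L.diff algebra_simps)
    qed
    then have "norm z \<le> t * norm z + \<bar>t - a\<bar> * norm (resolvent a x)"
      using norm_triangle_ineq[of "t *\<^sub>R L z" "(t - a) *\<^sub>R L (resolvent a x)"] t by simp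
    then show ?thesis using t by (simp add: z_def field_simps)
  qed
  have "((\<lambda>t. \<bar>t - a\<bar> * norm (resolvent a x) / (1 - t)) \<longlongrightarrow> \<bar>a - a\<bar> * norm (resolvent a x) / (1 - a)) ?F"
    using a by (intro tendsto_intros ident) auto
  then have "((\<lambda>t. \<bar>t - a\<bar> * norm (resolvent a x) / (1 - t)) \<longlongrightarrow> 0) ?F" by simp
  moreover have "\<forall>\<^sub>F t in ?F. norm (resolvent t x - resolvent a x)
      \<le> \<bar>t - a\<bar> * norm (resolvent a x) / (1 - t)"
    using ev by (rule eventually_mono) (rule bound)
  ultimately have "((\<lambda>t. resolvent t x - resolvent a x) \<longlongrightarrow> 0) ?F"
    by (rule Lim_null_comparison[rotated])
  then show ?thesis by (simp add: LIM_zero_iff)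
qed

text \<open>These are the Abel means of \<open>L\<close>. They are contractions, and on the dense
  range of \<open>1 - L\<close> the resolvent stays bounded, so the factor \<open>1 - t\<close>
  wins. The default \<open>0\<close> makes the contraction bound hold for every
  \<open>t\<close>.\<close>

lemma tendsto_scaled_resolvent:
  "((\<lambda>t. if t \<in> {0..<1} then (1 - t) *\<^sub>R resolvent t x else 0) \<longlongrightarrow> 0) (at 1 within {0..1})"
proof (rule equibounded_tendsto_zero[where X = "range (\<lambda>x. x - L x)" and
      T = "\<lambda>t x. if t \<in> {0..<1} then (1 - t) *\<^sub>R resolvent t x else 0"])
  show "bounded_linear (\<lambda>x. if t \<in> {0..<1} then (1 - t) *\<^sub>R resolvent t x else 0)" for t
  proof (cases "t \<in> {0..<1}")
    case True
    then show ?thesis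
      using bounded_linear_compose[OF bounded_linear_scaleR_right bounded_linear_resolvent] by simp
  next
    case False
    then have "(\<lambda>x. if t \<in> {0..<1} then (1 - t) *\<^sub>R resolvent t x else 0) = (\<lambda>x. 0)" by auto
    then show ?thesis using bounded_linear_zero by (simp only:)
  qed
  show "norm (if t \<in> {0..<1} then (1 - t) *\<^sub>R resolvent t x else 0) \<le> norm x" for t x
    using norm_resolvent_le[of t x] by auto
  show "closure (span (range (\<lambda>x. x - L x))) = UNIV"
    using dense_range closure_mono[OF span_superset[of "range (\<lambda>x. x - L x)"]] by auto
  fix x assume "x \<in> range (\<lambda>x. x - L x)"
  then obtain y where x: "x = y - L y" by blast
  have bound: "norm (if t \<in> {0..<1} then (1 - t) *\<^sub>R resolvent t x else 0) \<le> 4 * (1 - t) * norm y"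
    if "t > 1 / 2" "t \<le> 1" for t
  proof (cases "t = 1")
    case False
    then have t: "t \<in> {0..<1}" using that by auto
    define z where "z = resolvent t y"
    have z: "z = y + t *\<^sub>R L z" unfolding z_def by (rule resolvent[OF t])
    have "L z = L y + t *\<^sub>R L (L z)"
      using arg_cong[OF z, of L] by (simp add: L.add L.scaleR)
    \<comment> \<open>The resolvent commutes with \<open>L\<close>.\<close>
    then have res: "resolvent t x = z - L z"
      using z by (intro resolvent_eqI[OF t]) (simp add: x L.diff algebra_simps)
    have "t *\<^sub>R (z - L z) = y - (1 - t) *\<^sub>R z"
      using z by (simp add: algebra_simps)
    then have "norm (t *\<^sub>R (z - L z)) \<le> norm y + norm ((1 - t) *\<^sub>R z)"
      by (simp only: norm_triangle_ineq4)
    then have "t * norm (z - L z) \<le> 2 * norm y"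
      using norm_resolvent_le[OF t, of y] t by (simp add: z_def)
    \<comment> \<open>Only \<open>t\<close> near \<open>1\<close> matters; \<open>t > 1 / 2\<close>
      allows division by \<open>t\<close> and turns the factor \<open>2\<close> into
      \<open>4\<close>.\<close>
    moreover have "1 / 2 * norm (z - L z) \<le> t * norm (z - L z)"
      using that by (intro mult_right_mono) auto
    ultimately have "norm (z - L z) \<le> 4 * norm y" by simp
    then have "(1 - t) * norm (z - L z) \<le> (1 - t) * (4 * norm y)"
      using t by (intro mult_left_mono) auto
    then show ?thesis using t by (simp add: res mult_ac)
  qed simp
  show "((\<lambda>t. if t \<in> {0..<1} then (1 - t) *\<^sub>R resolvent t x else 0) \<longlongrightarrow> 0) (at 1 within {0..1})"
  proof (rule Lim_null_comparison)
    have "\<forall>\<^sub>F t in at (1::real) within {0..1}. t > 1 / 2"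
      by (rule order_tendstoD(1)[OF tendsto_ident_at]) simp
    moreover have "\<forall>\<^sub>F t in at (1::real) within {0..1}. t \<in> {0..1}"
      by (simp add: eventually_at_filter)
    ultimately show "\<forall>\<^sub>F t in at 1 within {0..1}.
        norm (if t \<in> {0..<1} then (1 - t) *\<^sub>R resolvent t x else 0) \<le> 4 * (1 - t) * norm y"
      by eventually_elim (use bound in auto)
    have "((\<lambda>t. 4 * (1 - t) * norm y) \<longlongrightarrow> 4 * (1 - 1) * norm y) (at 1 within {0..1})"
      by (intro tendsto_intros)
    then show "((\<lambda>t. 4 * (1 - t) * norm y) \<longlongrightarrow> 0) (at 1 within {0..1})" by simp
  qed
qed

text \<open>For \<open>a < 1\<close> continuity comes from the resolvent. At \<open>a = 1\<close>
  the difference from the identity is \<open>1 + L\<close> applied to an Abel mean, up to sign, and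
  Abel means tend to \<open>0\<close>.\<close>

lemma continuous_on_cayley: "continuous_on {0..1} (\<lambda>a. cayley a x)"
  unfolding continuous_on_def
proof
  fix a :: real assume a: "a \<in> {0..1}"
  show "((\<lambda>a. cayley a x) \<longlongrightarrow> cayley a x) (at a within {0..1})"
  proof (cases "a = 1")
    case False
    then have a: "a \<in> {0..<1}" using a by auto
    have "((\<lambda>t. t *\<^sub>R resolvent t x - L (resolvent t x)) \<longlongrightarrow> a *\<^sub>R resolvent a x - L (resolvent a x))
        (at a within {0..1})"
      by (intro tendsto_intros L.tendsto tendsto_resolvent[OF a])
    moreover have "\<forall>\<^sub>F t in at a within {0..1}. t < 1"
      using a by (intro order_tendstoD(2)[OF tendsto_ident_at]) simp
    then have "\<forall>\<^sub>F t in at a within {0..1}. t *\<^sub>R resolvent t x - L (resolvent t x) = cayley t x"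
      by eventually_elim (simp add: cayley_def)
    ultimately show ?thesis
      using False by (simp add: cayley_def[of a] Lim_transform_eventually)
  next
    case True
    have bound: "norm (cayley t x - x) \<le> 2 * norm (if t \<in> {0..<1} then (1 - t) *\<^sub>R resolvent t x else 0)"
      if "t \<in> {0..1}" for t
    proof (cases "t = 1")
      case False
      then have t: "t \<in> {0..<1}" using that by auto
      define z where "z = resolvent t x"
      have "z = x + t *\<^sub>R L z" unfolding z_def by (rule resolvent[OF t])
      then have "cayley t x - x = - ((1 - t) *\<^sub>R (z + L z))"
        using t by (simp add: cayley_def z_def[symmetric] algebra_simps)
      then have "norm (cayley t x - x) = (1 - t) * norm (z + L z)"
        using t by simp
      also have "\<dots> \<le> (1 - t) * (2 * norm z)"
        using t norm_triangle_ineq[of z "L z"] by (intro mult_left_mono) auto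
      finally show ?thesis using t by (simp add: z_def)
    qed (simp add: cayley_def)
    have "\<forall>\<^sub>F t in at (1 :: real) within {0..1}. t \<in> {0..1}"
      by (simp add: eventually_at_filter)
    then have "\<forall>\<^sub>F t in at 1 within {0..1}. norm (cayley t x - x)
        \<le> 2 * norm (if t \<in> {0..<1} then (1 - t) *\<^sub>R resolvent t x else 0)"
      by (rule eventually_mono[OF _ bound])
    moreover have "((\<lambda>t. 2 * norm (if t \<in> {0..<1} then (1 - t) *\<^sub>R resolvent t x else 0)) \<longlongrightarrow> 0)
        (at 1 within {0..1})"
      using tendsto_mult_right_zero[OF tendsto_norm_zero[OF tendsto_scaled_resolvent]] .
    ultimately have "((\<lambda>t. cayley t x - x) \<longlongrightarrow> 0) (at 1 within {0..1})"
      by (rule Lim_null_comparison)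
    then show ?thesis using True by (simp add: LIM_zero_iff cayley_def)
  qed
qed

text \<open>With \<open>x = z - a *\<^sub>R L z\<close> the value is
  \<open>a *\<^sub>R z - L z\<close>. In the two Gram products the mixed terms agree, and
  \<open>adj z * w\<close> has coefficient \<open>1 + a * a\<close> in both, as \<open>L\<close>
  preserves it.\<close>

lemma gram_preserving_cayley:
  assumes "a \<in> {0..1}"
  shows "gram_preserving (cayley a)"
  unfolding gram_preserving_def
proof (intro allI)
  fix x y
  show "adj (cayley a x) * cayley a y = adj x * y"
  proof (cases "a = 1")
    case False
    then have a: "a \<in> {0..<1}" using assms by auto
    define z w where "z = resolvent a x" and "w = resolvent a y"
    have x: "x = z - a *\<^sub>R L z" and y: "y = w - a *\<^sub>R L w"
      using resolvent[OF a, of x] resolvent[OF a, of y] by (simp_all add: z_def w_def algebra_simps)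
    have "adj (a *\<^sub>R z - L z) * (a *\<^sub>R w - L w) = adj (z - a *\<^sub>R L z) * (w - a *\<^sub>R L w)"
      by (simp add: adj_diff adj_scaleR algebra_simps gram_preservingD[OF gram])
    then show ?thesis using False unfolding cayley_def z_def[symmetric] w_def[symmetric]
      by (simp flip: x y)
  qed (simp add: cayley_def)
qed

lemma cayley_0: "cayley 0 x = - L x"
  using resolvent[of 0 x] by (simp add: cayley_def)

text \<open>The Cayley path joins \<open>- L\<close> to the identity within the set. A rotation
  between the orthogonal ranges of \<open>L\<close> and \<open>M\<close> then leads from
  \<open>- L V\<close> to \<open>M P\<close>, which lies in the set because
  \<open>adj P * P = P\<close>.\<close>

lemma contractible_partial_isometries_from:
  fixes M :: "'b \<Rightarrow> 'b" and P :: 'b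
  assumes M: "gram_preserving M" and LM: "\<And>x y. adj (L x) * M y = 0" and P: "is_projection P"
  shows "contractible (partial_isometries_from P)"
proof -
  let ?S = "partial_isometries_from P"
  have "homotopic_with_canon (\<lambda>_. True) ?S ?S (\<lambda>V. - L V) id"
  proof (rule homotopic_with_canonI)
    show "continuous_on ({0..1} \<times> ?S) (\<lambda>(a, V). cayley a V)"
      by (intro continuous_on_Times_if_nonexpansive continuous_on_cayley)
        (simp add: dist_gram_preserving[OF gram_preserving_cayley])
    show "cayley a V \<in> ?S" if "a \<in> {0..1}" "V \<in> ?S" for a V
      using that by (simp add: partial_isometries_from_def gram_preservingD[OF gram_preserving_cayley])
  qed (simp_all add: cayley_0, simp add: cayley_def)
  moreover have "homotopic_with_canon (\<lambda>_. True) ?S ?S (\<lambda>V. - L V) (\<lambda>V. M P)"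
  proof (rule homotopic_with_canonI)
    let ?h = "\<lambda>t V. sin (pi / 2 * t) *\<^sub>R M P - cos (pi / 2 * t) *\<^sub>R L V"
    show "continuous_on ({0..1} \<times> ?S) (\<lambda>(t, V). ?h t V)"
      unfolding case_prod_beta by (intro continuous_intros L.continuous_on)
    show "?h t V \<in> ?S" if "V \<in> ?S" for t V
    proof -
      have "adj (adj (L V) * M P) = 0" using LM by simp
      then have orth: "adj (M P) * L V = 0" by (simp add: adj_mult adj_adj)
      have "adj V * V = P" "adj P * P = P"
        using that P by (simp_all add: partial_isometries_from_def is_projection_def)
      \<comment> \<open>Orthogonality kills the mixed terms; both squares are multiples of
        \<open>P\<close>, whose coefficients add up to \<open>1\<close>.\<close>
      then have "adj (?h t V) * ?h t V = (cos (pi / 2 * t) * cos (pi / 2 * t)) *\<^sub>R P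
          + (sin (pi / 2 * t) * sin (pi / 2 * t)) *\<^sub>R P"
        by (simp add: adj_diff adj_scaleR algebra_simps LM orth gram_preservingD[OF M]
            gram_preservingD[OF gram])
      also have "\<dots> = P"
        by (simp only: sin_cos_squared_add3 scaleR_one flip: scaleR_add_left)
      finally show ?thesis by (simp add: partial_isometries_from_def)
    qed
  qed simp_all
  ultimately show ?thesis
    unfolding contractible_def using homotopic_with_trans homotopic_with_symD by blast
qed

end

theorem corollary4p3:
  fixes tensor :: "'h::complex_hilbert compact_op \<Rightarrow> 'a::cstar_algebra \<Rightarrow> 'b::cstar_algebra"
    and P :: 'b
  assumes "separable_space (euclidean :: 'h topology)"
    and "\<nexists>B :: 'h set. finite B \<and> complex_vector.span B = UNIV"
    and "is_cstar_tensor_product tensor"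
    and "is_projection P"
  shows "contractible (partial_isometries_from P)"
proof -
  interpret cstar_tensor_product tensor by unfold_locales (rule assms(3))
  obtain L M :: "'h compact_op \<Rightarrow> 'h compact_op" where "gram_preserving L" "gram_preserving M"
    "\<And>k l. adj (L k) * M l = 0" "closure (range (\<lambda>k. k - L k)) = UNIV"
    using ex_gram_preserving_compact_op[OF assms(1,2)] by blast
  from ex_gram_preserving_lift[OF this] obtain L' M' :: "'b \<Rightarrow> 'b" where
    L': "bounded_linear L'" "gram_preserving L'" "closure (range (\<lambda>x. x - L' x)) = UNIV" and
    M': "gram_preserving M'" "\<And>x y. adj (L' x) * M' y = 0"
    by blast
  interpret mean_ergodic_isometry L' by (intro mean_ergodic_isometry.intro L')
  show ?thesis using M' assms(4) by (rule contractible_partial_isometries_from)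
qed

end
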